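(* Let $F=\{f_1,\dots,f_s\}\subseteq K[x_1,\dots,x_n]$ be a finite set of polynomials that generates a zero-dimensional ideal $I$. Then the generalized border basis algorithm (described in the context), applied to $F$, computes the $\mathcal{O}$-border basis $\mathcal{G}$ of $I$ for any order ideal $\mathcal{O}\in\Lambda(I)$ chosen in its step (4).
   Context: $K$ is a field; $\mathbb{T}^n$ is the set of monomials in $x_1,\dots,x_n$; $\mathbb{T}^n_{\le d}$ and $\mathbb{T}^n_{=d}$ are the sets of monomials of total degree at most $d$, respectively exactly $d$. $\langle S\rangle_K$ denotes the $K$-linear span. An ideal $I$ is zero-dimensional if $K[x_1,\dots,x_n]/I$ is finite-dimensional over $K$. An order ideal is a finite subset $\mathcal{O}\subseteq\mathbb{T}^n$ closed under divisors; $\mathcal{O}^{=i}$ is its set of elements of degree $i$. Its border is $\partial\mathcal{O}=\{x_jt\mid 1\le j\le n,\ t\in\mathcal{O}\}\setminus\mathcal{O}$ if $\mathcal{O}\neq\emptyset$, and $\partial\emptyset=\{1\}$. For $\mathcal{O}=\{t_1,\dots,t_\mu\}$ with border $\{b_1,\dots,b_\nu\}$, the $\mathcal{O}$-border basis of $I$ (unique if it exists) is a set $\{g_1,\dots,g_\nu\}$ with $g_j=b_j-\sum_{i}\alpha_{ij}t_i$, $\alpha_{ij}\in K$, generating the ideal $I$, where moreover $K[x_1,\dots,x_n]=I\oplus\langle\mathcal{O}\rangle_K$ as vector spaces. $\mathcal{O}$ supports a border basis of $I$ if such a set exists. With $I^{\le i}=\{p\in I\mid\deg p\le i\}$ (including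 $0$; $I^{\le-1}=0$), $\mathcal{O}$ is degree-compatible to $I$ if $|\mathcal{O}^{=i}|=|\mathbb{T}^n_{=i}|-\dim(I^{\le i}/I^{\le i-1})$ for all $i\ge0$. $\Lambda(I)$ is the set of order ideals that are degree-compatible to $I$ and support a border basis of $I$. For a vector subspace $V$ of $K[x_1,\dots,x_n]$ put $V^+=V+Vx_1+\dots+Vx_n$. For an order ideal $L$ and a finite set $F$ of polynomials supported on $L$, the $L$-stable span $F_L$ is the smallest vector space $G\supseteq F$ with $G^+\cap\langle L\rangle_K=G$. Fix a degree-compatible term ordering; $\mathrm{LT}$ denotes leading terms with respect to it. Generalized border basis algorithm. Input: a finite generating set $F$ of a zero-dimensional ideal. (1) Let $d:=\max_{f\in F}\deg f$ and $L:=\mathbb{T}^n_{\le d}$. (2) Compute a vector space basis $V$ of the $L$-stable span $F_L$ with pairwise different leading terms. (3) If $\mathbb{T}^n_{=d}\not\subseteq\mathrm{LT}(V)=\{\mathrm{LT}(v)\mid v\in V\}$, set $d:=d+1$, $L:=\mathbb{T}^n_{\le d}$ and go to step (2). (4) Choose an order ideal $\mathcal{O}\in\Lambda(J)$, where $J$ is the ideal generated by $V$ (note $J=I$). (5) Return the result $\mathcal{G}$ of the basis transformation algorithm applied to $V$ and $\mathcal{O}$. Basis transformation algorithm. Input: $V$, $\mathcal{O}$. Let $\ell$ be the maximal degree of an element of $V$. Represent $V$ as a matrix whose rows are the coefficient vectors of the elements of $V$ and whose columns are indexed by $\mathbb{T}^n_{\le\ell}$, ordered so that every column indexed by an element of $\mathcal{O}$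 is to the right of every column indexed by a monomial of $\mathbb{T}^n_{\le\ell}\setminus\mathcal{O}$. Bring the matrix into reduced row echelon form by Gaussian elimination and let $\mathcal{G}'$ be the set of polynomials given by its nonzero rows. The head of a row is its left-most monomial with non-zero coefficient. Return $\mathcal{G}=\{g\in\mathcal{G}'\mid\mathrm{head}(g)\in\partial\mathcal{O}\}$. *)

theory Defs
  imports
    Complex_Main
    "HOL-Library.Poly_Mapping"
    "Jordan_Normal_Form.Gauss_Jordan_Elimination"
begin

text \<open>
  The indeterminates are indexed by a finite type \<open>'n\<close>. A monomial is its exponent vector, so
  the product of monomials is written \<open>+\<close> and the monomial 1 is \<open>0\<close>. A polynomial over the field
  \<open>'a\<close> is a finitely supported function from monomials to \<open>'a\<close>.
\<close>

type_synonym 'n monom = "'n \<Rightarrow>\<^sub>0 nat"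
type_synonym ('n, 'a) mpoly = "'n monom \<Rightarrow>\<^sub>0 'a"

definition mon :: "'n monom \<Rightarrow> ('n, 'a::field) mpoly" where
  "mon t = Poly_Mapping.single t 1"

definition ind :: "'n \<Rightarrow> 'n monom" where
  "ind j = Poly_Mapping.single j 1"

definition scale :: "'a::field \<Rightarrow> ('n, 'a) mpoly \<Rightarrow> ('n, 'a) mpoly" where
  "scale c p = Poly_Mapping.single 0 c * p"

global_interpretation vs: vector_space "scale :: 'a::field \<Rightarrow> ('n, 'a) mpoly \<Rightarrow> ('n, 'a) mpoly"
proof
  fix a b :: 'a and x y :: "('n, 'a) mpoly"
  show "scale a (x + y) = scale a x + scale a y" "scale (a + b) x = scale a x + scale b x"
    "scale a (scale b x) = scale (a * b) x" "scale 1 x = x"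
    by (simp_all add: scale_def distrib_left distrib_right single_add mult_single
        mult.assoc[symmetric])
qed

text \<open>Ideals are the submodules of the ring over itself.\<close>

global_interpretation ring: Modules.module "(*) :: 'r::comm_ring_1 \<Rightarrow> 'r \<Rightarrow> 'r"
  by standard (simp_all add: algebra_simps)

definition ideal_gen :: "('n, 'a::field) mpoly set \<Rightarrow> ('n, 'a) mpoly set" where
  "ideal_gen F = ring.span F"

definition mono_span :: "'n monom set \<Rightarrow> ('n, 'a::field) mpoly set" where
  "mono_span L = vs.span (mon ` L)"

definition mdeg :: "'n::finite monom \<Rightarrow> nat" where
  "mdeg t = (\<Sum>j\<in>UNIV. Poly_Mapping.lookup t j)"

text \<open>The zero polynomial gets degree 0. The maximum of the degrees over a set containing a nonzero
  polynomial does not depend on this convention.\<close>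

definition pdeg :: "('n::finite, 'a::field) mpoly \<Rightarrow> nat" where
  "pdeg p = (if p = 0 then 0 else Max (mdeg ` Poly_Mapping.keys p))"

definition monoms_le :: "nat \<Rightarrow> 'n::finite monom set" where
  "monoms_le d = {t. mdeg t \<le> d}"

definition monoms_eq :: "nat \<Rightarrow> 'n::finite monom set" where
  "monoms_eq d = {t. mdeg t = d}"

text \<open>\<open>quotient_basis V W B\<close>: the residue classes of the elements of the finite set \<open>B\<close> are
  pairwise different and form a basis of \<open>V / W\<close>, i.e. every residue class is a linear combination
  of them in exactly one way.\<close>

definition quotient_basis ::
    "('n, 'a::field) mpoly set \<Rightarrow> ('n, 'a) mpoly set \<Rightarrow> ('n, 'a) mpoly set \<Rightarrow> bool" where
  "quotient_basis V W B \<longleftrightarrow> finite B \<and> B \<subseteq> V \<and>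
     (\<forall>p\<in>V. \<exists>!c. (\<forall>b. b \<notin> B \<longrightarrow> c b = 0) \<and> p - (\<Sum>b\<in>B. scale (c b) b) \<in> W)"

definition quotient_dim :: "('n, 'a::field) mpoly set \<Rightarrow> ('n, 'a) mpoly set \<Rightarrow> nat" where
  "quotient_dim V W = (THE m. \<exists>B. quotient_basis V W B \<and> card B = m)"

definition zero_dimensional :: "('n, 'a::field) mpoly set \<Rightarrow> bool" where
  "zero_dimensional I \<longleftrightarrow> (\<exists>B. quotient_basis UNIV I B)"

definition order_ideal :: "'n monom set \<Rightarrow> bool" where
  "order_ideal \<O> \<longleftrightarrow> finite \<O> \<and> (\<forall>s t. s + t \<in> \<O> \<longrightarrow> s \<in> \<O>)"

definition border :: "'n monom set \<Rightarrow> 'n monom set" where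
  "border \<O> = (if \<O> = {} then {0} else {ind j + t | j t. t \<in> \<O>} - \<O>)"

definition border_basis ::
    "'n monom set \<Rightarrow> ('n, 'a::field) mpoly set \<Rightarrow> ('n, 'a) mpoly set \<Rightarrow> bool" where
  "border_basis \<O> I G \<longleftrightarrow>
     (\<exists>\<alpha>. G = (\<lambda>b. mon b - (\<Sum>t\<in>\<O>. scale (\<alpha> t b) (mon t))) ` border \<O>) \<and>
     ideal_gen G = I \<and>
     I \<inter> mono_span \<O> = {0} \<and> (\<forall>p. \<exists>q\<in>I. \<exists>r\<in>mono_span \<O>. p = q + r)"

text \<open>The integer bound makes \<open>I\<^sup>\<le>\<^sup>-\<^sup>1 = 0\<close> available.\<close>

definition ideal_le :: "('n::finite, 'a::field) mpoly set \<Rightarrow> int \<Rightarrow> ('n, 'a) mpoly set" where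
  "ideal_le I i = {p \<in> I. p = 0 \<or> int (pdeg p) \<le> i}"

definition degree_compatible :: "'n::finite monom set \<Rightarrow> ('n, 'a::field) mpoly set \<Rightarrow> bool" where
  "degree_compatible \<O> I \<longleftrightarrow>
     (\<forall>i::nat. int (card {t \<in> \<O>. mdeg t = i}) =
        int (card (monoms_eq i :: 'n monom set))
          - int (quotient_dim (ideal_le I (int i)) (ideal_le I (int i - 1))))"

definition \<Lambda> :: "('n::finite, 'a::field) mpoly set \<Rightarrow> 'n monom set set" where
  "\<Lambda> I = {\<O>. order_ideal \<O> \<and> degree_compatible \<O> I \<and> (\<exists>G. border_basis \<O> I G)}"

text \<open>A term ordering is given as the set of pairs \<open>(s, t)\<close> with \<open>s\<close> less than or equal to \<open>t\<close>.\<close>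

definition term_ordering :: "'n monom rel \<Rightarrow> bool" where
  "term_ordering \<sigma> \<longleftrightarrow> linear_order \<sigma> \<and> (\<forall>t. (0, t) \<in> \<sigma>) \<and>
     (\<forall>s t u. (s, t) \<in> \<sigma> \<longrightarrow> (s + u, t + u) \<in> \<sigma>)"

definition degree_compatible_ordering :: "'n::finite monom rel \<Rightarrow> bool" where
  "degree_compatible_ordering \<sigma> \<longleftrightarrow> term_ordering \<sigma> \<and> (\<forall>s t. (s, t) \<in> \<sigma> \<longrightarrow> mdeg s \<le> mdeg t)"

definition LT :: "'n monom rel \<Rightarrow> ('n, 'a::field) mpoly \<Rightarrow> 'n monom" where
  "LT \<sigma> p = (THE t. t \<in> Poly_Mapping.keys p \<and> (\<forall>s\<in>Poly_Mapping.keys p. (s, t) \<in> \<sigma>))"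

definition plus_space :: "('n::finite, 'a::field) mpoly set \<Rightarrow> ('n, 'a) mpoly set" where
  "plus_space V = {p + (\<Sum>j\<in>UNIV. q j * mon (ind j)) | p q. p \<in> V \<and> (\<forall>j. q j \<in> V)}"

definition stable_span ::
    "('n::finite, 'a::field) mpoly set \<Rightarrow> 'n monom set \<Rightarrow> ('n, 'a) mpoly set" where
  "stable_span F L =
     (LEAST G. vs.subspace G \<and> F \<subseteq> G \<and> plus_space G \<inter> mono_span L = G)"

definition coeff_matrix :: "('n, 'a::field) mpoly list \<Rightarrow> 'n monom list \<Rightarrow> 'a mat" where
  "coeff_matrix ps ts =
     mat (length ps) (length ts) (\<lambda>(i, j). Poly_Mapping.lookup (ps ! i) (ts ! j))"

definition row_poly :: "'n monom list \<Rightarrow> 'a::field mat \<Rightarrow> nat \<Rightarrow> ('n, 'a) mpoly" where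
  "row_poly ts M i = (\<Sum>j<length ts. Poly_Mapping.single (ts ! j) (M $$ (i, j)))"

definition head :: "'n monom list \<Rightarrow> ('n, 'a::field) mpoly \<Rightarrow> 'n monom" where
  "head ts p = hd (filter (\<lambda>t. Poly_Mapping.lookup p t \<noteq> 0) ts)"

text \<open>The basis transformation algorithm. The relation ranges over all enumerations \<open>vs\<close> of the
  rows and all admissible enumerations \<open>ts\<close> of the columns.
  The function \<open>gauss_jordan_single\<close> computes the reduced row echelon form.\<close>

definition basis_transformation ::
    "('n::finite, 'a::field) mpoly set \<Rightarrow> 'n monom set \<Rightarrow> ('n, 'a) mpoly set \<Rightarrow> bool" where
  "basis_transformation V \<O> G \<longleftrightarrow>
     (\<exists>vs ts M G'.
        distinct vs \<and> set vs = V \<and>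
        distinct ts \<and> set ts = monoms_le (Max (pdeg ` V)) \<and>
        (\<forall>i j. i < length ts \<and> j < length ts \<and> ts ! i \<notin> \<O> \<and> ts ! j \<in> \<O> \<longrightarrow> i < j) \<and>
        M = gauss_jordan_single (coeff_matrix vs ts) \<and>
        G' = {row_poly ts M i | i. i < dim_row M} - {0} \<and>
        G = {g \<in> G'. head ts g \<in> border \<O>})"

text \<open>The generalized border basis algorithm as a transition system. The states are named after
  the step to be executed next; the final state records the chosen order ideal and the result.
  The bound \<open>L\<close> is always \<open>monoms_le d\<close>.\<close>

datatype ('m, 'p) state =
    Step2 nat
  | Step3 nat "'p set"
  | Step4 "'p set"
  | Step5 "'p set" "'m set"
  | Returned "'m set" "'p set"

type_synonym ('n, 'a) gbb_state = "('n monom, ('n, 'a) mpoly) state"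

definition gbb_start :: "('n::finite, 'a::field) mpoly set \<Rightarrow> ('n, 'a) gbb_state" where
  "gbb_start F = Step2 (Max (pdeg ` F))"

inductive gbb_step ::
    "'n::finite monom rel \<Rightarrow> ('n, 'a::field) mpoly set \<Rightarrow>
     ('n, 'a) gbb_state \<Rightarrow> ('n, 'a) gbb_state \<Rightarrow> bool"
  for \<sigma> F where
  compute: "\<lbrakk>vs.independent V; vs.span V = stable_span F (monoms_le d); inj_on (LT \<sigma>) V\<rbrakk>
    \<Longrightarrow> gbb_step \<sigma> F (Step2 d) (Step3 d V)"
| enlarge: "\<not> monoms_eq d \<subseteq> LT \<sigma> ` V \<Longrightarrow> gbb_step \<sigma> F (Step3 d V) (Step2 (d + 1))"
| proceed: "monoms_eq d \<subseteq> LT \<sigma> ` V \<Longrightarrow> gbb_step \<sigma> F (Step3 d V) (Step4 V)"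
| choose: "\<O> \<in> \<Lambda> (ideal_gen V) \<Longrightarrow> gbb_step \<sigma> F (Step4 V) (Step5 V \<O>)"
| return: "basis_transformation V \<O> G \<Longrightarrow> gbb_step \<sigma> F (Step5 V \<O>) (Returned \<O> G)"

definition gbb_reachable ::
    "'n::finite monom rel \<Rightarrow> ('n, 'a::field) mpoly set \<Rightarrow> ('n, 'a) gbb_state \<Rightarrow> bool" where
  "gbb_reachable \<sigma> F = (gbb_step \<sigma> F)\<^sup>*\<^sup>* (gbb_start F)"

end

(*
  Let L be the monomials of degree at most d and U the L-stable span of F. Once every monomial of
  degree d is a leading term of U, <L> splits into U and a space of polynomials of degree below d;
  reducing x_j p modulo U gives operators on that space, which commute because U is stable, and the
  resulting action of the polynomial ring shows that the ideal generated by U meets <L> only in U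
  (Mourrain's criterion). Hence U consists of all elements of I of degree at most d.

  This happens for large d: the monomials outside LT(I) are independent modulo I, so finite in
  number, and every element of I lies in the stable span for all large d. The monomials outside
  LT(I) also form a member of Lambda(I), so the choice in step 4 is always possible.

  For O in Lambda(I), degree compatibility forces O to have no monomial of degree d. So the border of
  O lies in L, and every b in L outside O has a representation b = g_b + r with g_b in U and r in <O>.
  No row of the reduced echelon form has its pivot in O, since it would lie in the intersection
  of I and <O>; comparing entries at pivots, the row with pivot b is exactly g_b.
*)
theory Submission
  imports Defs "HOL-Library.Multiset"
begin

text \<open>The test in step (3) makes room: U then has a complement in degrees below d, where one
  multiplication by an indeterminate stays inside <L>, the only range in which stability gives
  information.

  The ordering is degree-compatible, so the leading terms of degree i in I count the dimension of
  the elements of degree at most i modulo those of degree at most i - 1. Membership in Lambda(I)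
  thereby becomes partly a matter of counting monomials.

  An order ideal in Lambda(I) need not be the complement of LT(I), so the leading terms of V do not
  predict the pivots of the echelon form. The last stage therefore relies only on the direct
  decomposition into I and <O> and on the degree bound for O; these determine the result whatever
  basis V and whatever enumeration of rows and columns was taken.

  No explicit bound for the final d is computed. Being in the stable span is treated as a property
  that holds for all sufficiently large d, which is compatible with finite conjunctions.\<close>

abbreviation (input) "keys \<equiv> Poly_Mapping.keys"
abbreviation (input) "lookup \<equiv> Poly_Mapping.lookup"

interpretation vsp: vector_space_pair
  "scale :: 'a::field \<Rightarrow> ('n, 'a) mpoly \<Rightarrow> ('n, 'a) mpoly"
  "scale :: 'a::field \<Rightarrow> ('n, 'a) mpoly \<Rightarrow> ('n, 'a) mpoly"
  by unfold_locales

section \<open>Monomials and supports\<close>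

lemma lookup_scale [simp]: "lookup (scale c p) t = c * lookup p t"
  unfolding scale_def mult_map_scale_conv_mult[symmetric]
  by (simp add: Poly_Mapping.map.rep_eq when_def)

lemma lookup_mon: "lookup (mon s) t = (if s = t then 1 else 0)"
  by (simp add: mon_def lookup_single when_def)

lemma keys_mon [simp]: "keys (mon t :: ('n, 'a::field) mpoly) = {t}"
  by (simp add: mon_def)

lemma mon_neq_0 [simp]: "(mon t :: ('n, 'a::field) mpoly) \<noteq> 0"
  by (metis keys_mon keys_zero insert_not_empty)

lemma inj_mon: "inj_on (mon :: _ \<Rightarrow> ('n, 'a::field) mpoly) S"
  by (rule inj_onI) (metis keys_mon singleton_inject)

lemma mon_0: "mon 0 = 1"
  by (simp add: mon_def)

lemma mon_add: "mon (s + t) = mon s * mon t"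
  by (simp add: mon_def mult_single)

lemma keys_scale: "keys (scale c p) \<subseteq> keys p"
  by (auto simp: in_keys_iff)

lemma poly_expand: "(\<Sum>t\<in>keys p. scale (lookup p t) (mon t)) = p"
proof (rule poly_mapping_eqI)
  fix s
  have "lookup (\<Sum>t\<in>keys p. scale (lookup p t) (mon t)) s
      = (\<Sum>t\<in>keys p. if t = s then lookup p t else 0)"
    by (simp add: lookup_sum lookup_mon if_distrib cong: if_cong)
  also have "\<dots> = lookup p s"
    by (simp add: in_keys_iff)
  finally show "lookup (\<Sum>t\<in>keys p. scale (lookup p t) (mon t)) s = lookup p s" .
qed

lemma scale_mult_right: "q * scale c p = scale c (q * p)"
  unfolding scale_def by (rule mult.left_commute)

lemma scale_mult_left: "scale c p * q = scale c (p * q)"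
  unfolding scale_def by (rule mult.assoc)

lemma lookup_mon_mult: "lookup (mon s * p) (s + u) = lookup p u"
proof -
  have "mon s * p = mon s * (\<Sum>t\<in>keys p. scale (lookup p t) (mon t))"
    by (simp add: poly_expand)
  also have "\<dots> = (\<Sum>t\<in>keys p. scale (lookup p t) (mon (s + t)))"
    by (simp add: sum_distrib_left scale_mult_right mon_add)
  also have "lookup \<dots> (s + u) = (\<Sum>t\<in>keys p. if t = u then lookup p t else 0)"
    by (simp add: lookup_sum lookup_mon if_distrib cong: if_cong)
  also have "\<dots> = lookup p u"
    by (simp add: in_keys_iff)
  finally show ?thesis .
qed

text \<open>Translation by a monomial is injective, so nothing cancels and the inclusion
  \<open>keys_mult\<close> becomes an equality. Leading terms of multiples need both
  directions.\<close>

lemma keys_mon_mult: "keys (mon s * p) = (+) s ` keys (p :: ('n, 'a::field) mpoly)"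
proof
  show "keys (mon s * p) \<subseteq> (+) s ` keys p"
    using keys_mult[of "mon s" p] by auto
  show "(+) s ` keys p \<subseteq> keys (mon s * p)"
    by (auto simp: in_keys_iff lookup_mon_mult)
qed

lemma subspace_keys: "vs.subspace {p :: ('n, 'a::field) mpoly. keys p \<subseteq> L}"
proof (rule vs.subspaceI)
  show "x + y \<in> {p. keys p \<subseteq> L}" if "x \<in> {p. keys p \<subseteq> L}" "y \<in> {p. keys p \<subseteq> L}"
    for x y :: "('n, 'a) mpoly"
    using that keys_add[of x y] by auto
  show "scale c x \<in> {p. keys p \<subseteq> L}" if "x \<in> {p. keys p \<subseteq> L}" for c and x :: "('n, 'a) mpoly"
    using that keys_scale[of c x] by auto
qed simp

lemma in_mono_span_iff: "p \<in> mono_span L \<longleftrightarrow> keys (p :: ('n, 'a::field) mpoly) \<subseteq> L"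
proof
  assume "p \<in> mono_span L"
  moreover have "mono_span L \<subseteq> {p :: ('n, 'a) mpoly. keys p \<subseteq> L}"
    unfolding mono_span_def by (rule vs.span_minimal) (auto simp: subspace_keys)
  ultimately show "keys p \<subseteq> L" by auto
next
  assume "keys p \<subseteq> L"
  then have "(\<Sum>t\<in>keys p. scale (lookup p t) (mon t)) \<in> mono_span L"
    unfolding mono_span_def by (intro vs.span_sum vs.span_scale vs.span_base) auto
  then show "p \<in> mono_span L" by (simp add: poly_expand)
qed

lemma subspace_mono_span [simp]: "vs.subspace (mono_span L)"
  by (simp add: mono_span_def)

lemma mono_span_mono: "L \<subseteq> L' \<Longrightarrow> mono_span L \<subseteq> mono_span L'"
  by (auto simp: in_mono_span_iff)

lemma mon_in_mono_span [simp]: "(mon t :: ('n, 'a::field) mpoly) \<in> mono_span L \<longleftrightarrow> t \<in> L"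
  by (simp add: in_mono_span_iff)

lemma independent_mon: "vs.independent (mon ` S :: ('n, 'a::field) mpoly set)"
  unfolding vs.dependent_def
proof safe
  fix t assume "t \<in> S" and *: "(mon t :: ('n, 'a) mpoly) \<in> vs.span (mon ` S - {mon t})"
  have "mon ` S - {mon t} = (mon ` (S - {t}) :: ('n, 'a) mpoly set)"
    by (auto dest: inj_onD[OF inj_mon])
  with * have "(mon t :: ('n, 'a) mpoly) \<in> mono_span (S - {t})"
    by (simp add: mono_span_def)
  then show False by simp
qed

section \<open>Degrees and divisors of monomials\<close>

lemma mdeg_add: "mdeg (s + t) = mdeg s + mdeg t"
  by (simp add: mdeg_def lookup_add sum.distrib)

lemma mdeg_single [simp]: "mdeg (Poly_Mapping.single j k) = k"
  by (simp add: mdeg_def lookup_single when_def)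

lemma mdeg_ind [simp]: "mdeg (ind j) = 1"
  by (simp add: ind_def)

lemma mdeg_0 [simp]: "mdeg 0 = 0"
  by (simp add: mdeg_def)

lemma mdeg_eq_0: "mdeg t = 0 \<longleftrightarrow> t = 0"
proof
  assume "mdeg t = 0"
  then show "t = 0" by (intro poly_mapping_eqI) (simp add: mdeg_def)
qed simp

lemma monom_ind_factor:
  assumes "lookup t j > 0"
  shows "\<exists>s. t = ind j + s"
proof
  show "t = ind j + (t - ind j)"
    using assms by (intro poly_mapping_eqI) (auto simp: ind_def lookup_add lookup_minus lookup_single when_def)
qed

lemma monom_cases: 
  obtains "t = 0" | j s where "t = ind j + s"
proof (cases "t = 0")
  case False
  then have "keys t \<noteq> {}" by simp
  then obtain j where "j \<in> keys t" by blast
  then have "lookup t j > 0" by (simp add: in_keys_iff)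
  from monom_ind_factor[OF this] that(2) show ?thesis by blast
qed

lemma monom_induct [case_names zero step]:
  fixes t :: "'n::finite monom"
  assumes "P 0" and "\<And>j t. P t \<Longrightarrow> P (ind j + t)"
  shows "P t"
proof (induction "mdeg t" arbitrary: t rule: less_induct)
  case less
  show ?case
  proof (cases t rule: monom_cases)
    case (2 j s)
    then show ?thesis using less[of s] assms(2) by (simp add: mdeg_add)
  qed (use assms(1) in simp)
qed

text \<open>Each indeterminate adds exactly one to the degree, so building up t skips no value. This
  provides divisors of a prescribed degree for monomials of large degree.\<close>

lemma monom_degree_factor:
  fixes t :: "'n::finite monom"
  assumes "k \<le> mdeg t"
  shows "\<exists>r s. t = r + s \<and> mdeg s = k"
  using assms
proof (induction t rule: monom_induct)
  case zero
  then show ?case by (metis add_0 le_zero_eq mdeg_0)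
next
  case (step j t)
  show ?case
  proof (cases "k \<le> mdeg t")
    case True
    then show ?thesis using step.IH by (metis add.assoc)
  next
    case False
    then have "k = mdeg (ind j + t)" using step.prems by (simp add: mdeg_add)
    then show ?thesis by (metis add_0)
  qed
qed

lemma finite_monoms_le [simp]: "finite (monoms_le d :: 'n::finite monom set)"
proof (induction d)
  case 0
  have "monoms_le 0 = {0 :: 'n monom}" by (auto simp: monoms_le_def mdeg_eq_0)
  then show ?case by simp
next
  case (Suc d)
  have "monoms_le (Suc d) \<subseteq> insert 0 (\<Union>j. (+) (ind j) ` (monoms_le d :: 'n monom set))"
  proof
    fix t :: "'n monom" assume "t \<in> monoms_le (Suc d)"
    then show "t \<in> insert 0 (\<Union>j. (+) (ind j) ` monoms_le d)"
      by (cases t rule: monom_cases) (auto simp: monoms_le_def mdeg_add)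
  qed
  then show ?case using Suc by (simp add: finite_subset)
qed

lemma finite_monoms_eq [simp]: "finite (monoms_eq d :: 'n::finite monom set)"
  by (rule finite_subset[OF _ finite_monoms_le[of d]]) (auto simp: monoms_le_def monoms_eq_def)

lemma monoms_eq_nonempty: "monoms_eq d \<noteq> ({} :: 'n::finite monom set)"
proof -
  \<comment> \<open>Types are inhabited, so there is at least one indeterminate; the witness is its
    d-th power.\<close>
  have "Poly_Mapping.single undefined d \<in> (monoms_eq d :: 'n monom set)"
    by (simp add: monoms_eq_def)
  then show ?thesis by blast
qed

lemma mdeg_le_pdeg: "t \<in> keys p \<Longrightarrow> mdeg t \<le> pdeg p"
  by (auto simp: pdeg_def)

lemma pdeg_attained: "p \<noteq> 0 \<Longrightarrow> \<exists>t\<in>keys p. mdeg t = pdeg p"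
proof -
  assume "p \<noteq> 0"
  then have "Max (mdeg ` keys p) \<in> mdeg ` keys p" by (intro Max_in) auto
  then obtain t where "Max (mdeg ` keys p) = mdeg t" "t \<in> keys p" by (rule imageE)
  with \<open>p \<noteq> 0\<close> show ?thesis by (intro bexI[of _ t]) (simp_all add: pdeg_def)
qed

text \<open>The disjunct p = 0 repairs the convention that 0 has degree 0: for negative k no
  monomial is left and the span is 0, which is the case of degree at most -1.\<close>

lemma pdeg_le_iff: "p = 0 \<or> int (pdeg p) \<le> k \<longleftrightarrow> p \<in> mono_span {t. int (mdeg t) \<le> k}"
proof (cases "p = 0")
  case False
  then obtain t where "t \<in> keys p" "mdeg t = pdeg p" using pdeg_attained by blast
  then show ?thesis using False mdeg_le_pdeg by (fastforce simp: in_mono_span_iff)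
qed (simp add: in_mono_span_iff)

lemma ideal_le_eq: "ideal_le I k = I \<inter> mono_span {t. int (mdeg t) \<le> k}"
  unfolding ideal_le_def pdeg_le_iff by auto

lemma in_monoms_le_span: "pdeg p \<le> d \<Longrightarrow> p \<in> mono_span (monoms_le d)"
  using mdeg_le_pdeg by (fastforce simp: in_mono_span_iff monoms_le_def)

section \<open>Ideals and stable spans\<close>

lemma ring_subspace_imp_subspace: "ring.subspace J \<Longrightarrow> vs.subspace J"
  unfolding scale_def
  by (intro vs.subspaceI[unfolded scale_def] ring.subspace_0 ring.subspace_add ring.subspace_scale)

text \<open>Closure under indeterminates gives closure under monomials, and linearity does the rest.
  Kernels and sets defined by a limit are recognized as ideals this way.\<close>

lemma ideal_of_ind_closed:
  fixes J :: "('n::finite, 'a::field) mpoly set"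
  assumes J: "vs.subspace J" and step: "\<And>j p. p \<in> J \<Longrightarrow> mon (ind j) * p \<in> J"
  shows "ring.subspace J"
proof (rule ring.subspaceI)
  have mon: "mon t * p \<in> J" if "p \<in> J" for t p
  proof (induction t rule: monom_induct)
    case zero
    show ?case using that by (simp add: mon_0)
  next
    case (step j t)
    from assms(2)[OF this] show ?case by (simp only: mon_add mult.assoc)
  qed
  fix q p assume p: "p \<in> J"
  have "(\<Sum>t\<in>keys q. scale (lookup q t) (mon t)) * p \<in> J"
    unfolding sum_distrib_right scale_mult_left
    by (intro vs.subspace_sum vs.subspace_scale J mon p)
  then show "q * p \<in> J" by (simp only: poly_expand)
qed (use J in \<open>simp_all add: vs.subspace_0 vs.subspace_add\<close>)

lemma subspace_ideal_gen: "ring.subspace (ideal_gen F)"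
  by (simp add: ideal_gen_def)

lemma ideal_gen_superset: "F \<subseteq> ideal_gen F"
  by (simp add: ideal_gen_def ring.span_superset)

lemma ideal_gen_minimal: "F \<subseteq> J \<Longrightarrow> ring.subspace J \<Longrightarrow> ideal_gen F \<subseteq> J"
  unfolding ideal_gen_def by (rule ring.span_minimal)

section \<open>Extension by the indeterminates, stable spaces and the stable span\<close>

lemma in_plus_space: "vs.subspace G \<Longrightarrow> p \<in> G \<Longrightarrow> p \<in> plus_space G"
  unfolding plus_space_def
  by (auto intro!: exI[of _ p] exI[of _ "\<lambda>_. 0"] vs.subspace_0)

text \<open>\<open>plus_space\<close> allots one coefficient to each indeterminate, so for i = j the
  two contributions have to be merged, as u does. The difference is the shape that occurs when
  commutation is checked; one of p, q equal to 0 covers a single product.\<close>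

lemma plus_space_two:
  assumes G: "vs.subspace G" and "p \<in> G" "q \<in> G"
  shows "mon (ind i) * p - mon (ind j) * q \<in> plus_space G"
proof -
  define u where "u k = (if k = i then p else 0) - (if k = j then q else 0)" for k
  have "u k * mon (ind k) = (if k = i then mon (ind k) * p else 0) - (if k = j then mon (ind k) * q else 0)" for k
    unfolding u_def left_diff_distrib mult.commute[of _ "mon (ind k)"] by (simp add: right_diff_distrib split: if_split)
  then have "(\<Sum>k\<in>UNIV. u k * mon (ind k)) = mon (ind i) * p - mon (ind j) * q"
    by (simp add: sum_subtractf)
  moreover have "u k \<in> G" for k
    unfolding u_def using assms by (intro vs.subspace_diff) (simp_all add: vs.subspace_0)
  ultimately show ?thesis
    unfolding plus_space_def using vs.subspace_0[OF G]
    by (intro CollectI exI[of _ 0] exI[of _ u]) simp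
qed

lemma plus_space_subset_ideal:
  assumes "ring.subspace J" "G \<subseteq> J"
  shows "plus_space G \<subseteq> J"
proof
  fix r assume "r \<in> plus_space G"
  then obtain p q where r: "r = p + (\<Sum>j\<in>UNIV. q j * mon (ind j))" and "p \<in> G" "\<And>j. q j \<in> G"
    by (auto simp: plus_space_def)
  then have "mon (ind j) * q j \<in> J" for j
    using assms by (intro ring.subspace_scale) auto
  then have "q j * mon (ind j) \<in> J" for j
    by (simp only: mult.commute)
  then show "r \<in> J"
    unfolding r using assms \<open>p \<in> G\<close> by (intro ring.subspace_add ring.subspace_sum) auto
qed

lemma plus_space_mono: "G \<subseteq> H \<Longrightarrow> plus_space G \<subseteq> plus_space H"
  unfolding plus_space_def by blast

text \<open>As \<open>plus_space G\<close> contains G, the equation says that G lies in <L> and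
  absorbs whatever part of \<open>plus_space G\<close> falls into <L>. This includes sums of
  products that leave <L> one by one and return to it only by cancellation.\<close>

definition stable_in :: "('n::finite, 'a::field) mpoly set \<Rightarrow> 'n monom set \<Rightarrow> bool" where
  "stable_in G L \<longleftrightarrow> vs.subspace G \<and> plus_space G \<inter> mono_span L = G"

lemma stable_in_mult:
  assumes "stable_in G L" "p \<in> G" "mon (ind j) * p \<in> mono_span L"
  shows "mon (ind j) * p \<in> G"
proof -
  have "vs.subspace G" using assms(1) by (simp add: stable_in_def)
  then have "mon (ind j) * p \<in> plus_space G"
    using plus_space_two[of G p 0 j j] assms(2) by (simp add: vs.subspace_0)
  then show ?thesis using assms unfolding stable_in_def by blast
qed

lemma stable_inI:
  assumes "vs.subspace G" "G \<subseteq> mono_span L" "plus_space G \<inter> mono_span L \<subseteq> G"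
  shows "stable_in G L"
  using assms in_plus_space unfolding stable_in_def by blast

text \<open>An ideal absorbs its own extension by the indeterminates. The instance with J the whole
  ring shows that <L> itself is stable; general J bounds the stable span from above.\<close>

lemma ideal_stable_in: "ring.subspace J \<Longrightarrow> stable_in (J \<inter> mono_span L) L"
  using plus_space_subset_ideal[of J "J \<inter> mono_span L"]
  by (intro stable_inI vs.subspace_inter ring_subspace_imp_subspace subspace_mono_span) auto

text \<open>\<open>plus_space\<close> is monotone, so stability survives intersections, and the
  least element with respect to inclusion exists. The family is nonempty since <L> is a stable space
  containing F.\<close>

lemma stable_span_eq_Inter:
  assumes F: "F \<subseteq> mono_span L"
  shows "stable_span F L = \<Inter>{G. F \<subseteq> G \<and> stable_in G L}" (is "_ = ?S")
  unfolding stable_span_def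
proof (rule Least_equality)
  have top: "F \<subseteq> mono_span L \<and> stable_in (mono_span L) L"
    using F ideal_stable_in[OF ring.subspace_UNIV, of L] by simp
  have "stable_in ?S L"
  proof (rule stable_inI)
    show "vs.subspace ?S" by (rule vs.subspace_Inter) (auto simp: stable_in_def)
    show "?S \<subseteq> mono_span L" using top by blast
    have "plus_space ?S \<inter> mono_span L \<subseteq> G" if "F \<subseteq> G" "stable_in G L" for G
      using plus_space_mono[of ?S G] that unfolding stable_in_def by blast
    then show "plus_space ?S \<inter> mono_span L \<subseteq> ?S" by blast
  qed
  then show "vs.subspace ?S \<and> F \<subseteq> ?S \<and> plus_space ?S \<inter> mono_span L = ?S"
    by (auto simp: stable_in_def)
qed (auto simp: stable_in_def)

lemma
  assumes "F \<subseteq> mono_span L"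
  shows stable_span_superset: "F \<subseteq> stable_span F L"
    and stable_span_minimal: "F \<subseteq> G \<Longrightarrow> stable_in G L \<Longrightarrow> stable_span F L \<subseteq> G"
  unfolding stable_span_eq_Inter[OF assms] by auto

lemma stable_span_stable:
  assumes "F \<subseteq> mono_span L"
  shows "stable_in (stable_span F L) L"
proof (rule stable_inI)
  show "vs.subspace (stable_span F L)"
    unfolding stable_span_eq_Inter[OF assms]
    by (rule vs.subspace_Inter) (auto simp: stable_in_def)
  show "stable_span F L \<subseteq> mono_span L"
    using stable_span_minimal[OF assms assms] ideal_stable_in[OF ring.subspace_UNIV, of L] by simp
  have "plus_space (stable_span F L) \<inter> mono_span L \<subseteq> G" if "F \<subseteq> G" "stable_in G L" for G
    using plus_space_mono[OF stable_span_minimal[OF assms that]] that unfolding stable_in_def by blast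
  then show "plus_space (stable_span F L) \<inter> mono_span L \<subseteq> stable_span F L"
    unfolding stable_span_eq_Inter[OF assms] by blast
qed

lemma stable_span_subset_ideal:
  assumes "F \<subseteq> mono_span L" "ring.subspace J" "F \<subseteq> J"
  shows "stable_span F L \<subseteq> J \<inter> mono_span L"
  using assms by (intro stable_span_minimal ideal_stable_in) auto

text \<open>The stable span is squeezed between F and the ideal of F. This is the claim J = I in
  step (4).\<close>

lemma ideal_gen_stable_span:
  assumes F: "F \<subseteq> mono_span L" and V: "vs.span V = stable_span F L"
  shows "ideal_gen V = ideal_gen F"
proof
  have "stable_span F L \<subseteq> ideal_gen F"
    using stable_span_subset_ideal[OF F subspace_ideal_gen ideal_gen_superset] by auto
  then show "ideal_gen V \<subseteq> ideal_gen F"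
    using V vs.span_superset[of V] by (intro ideal_gen_minimal subspace_ideal_gen) auto
  have "vs.span V \<subseteq> ideal_gen V"
    by (intro vs.span_minimal ideal_gen_superset ring_subspace_imp_subspace subspace_ideal_gen)
  then show "ideal_gen F \<subseteq> ideal_gen V"
    using V stable_span_superset[OF F] by (intro ideal_gen_minimal subspace_ideal_gen) auto
qed

section \<open>Complements and quotients\<close>

context vector_space
begin

text \<open>A basis of U is extended by vectors of S; the map kills the former and fixes the latter.
  U and span S may intersect nontrivially: the values then lie in a part of span S that is
  complementary to U.\<close>

lemma projection_along:
  assumes U: "subspace U"
  shows "\<exists>\<pi>. Vector_Spaces.linear scale scale \<pi> \<and> (\<forall>p. \<pi> p \<in> span S) \<and>
    (\<forall>u\<in>U. \<pi> u = 0) \<and> (\<forall>p\<in>span (U \<union> S). p - \<pi> p \<in> U)"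
proof -
  interpret pair: vector_space_pair scale scale by unfold_locales
  obtain A where A: "A \<subseteq> U" "independent A" "U \<subseteq> span A"
    using maximal_independent_subset[of U] by blast
  obtain B where B: "A \<subseteq> B" "B \<subseteq> A \<union> S" "independent B" "A \<union> S \<subseteq> span B"
    using maximal_independent_subset_extend[of A "A \<union> S"] A(2) by blast
  define f where "f b = (if b \<in> A then 0 else b)" for b
  obtain \<pi> where \<pi>: "Vector_Spaces.linear scale scale \<pi>" "\<forall>x\<in>B. \<pi> x = f x" "range \<pi> = span (f ` B)"
    using pair.linear_independent_extend_subspace[OF B(3), of f] by blast
  have 0: "\<pi> u = 0" if "u \<in> U" for u
  proof (rule pair.linear_eq_0_on_span[OF \<pi>(1)])
    show "u \<in> span A" using A(3) that by blast
    show "\<pi> x = 0" if "x \<in> A" for x using \<pi>(2) that B(1) by (auto simp: f_def)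
  qed
  show ?thesis
  proof (intro exI[of _ \<pi>] conjI allI ballI)
    show "Vector_Spaces.linear scale scale \<pi>" by fact
    have "f ` B \<subseteq> span S" using B(2) by (auto simp: f_def span_base span_zero)
    then show "\<pi> p \<in> span S" for p
      using span_minimal[OF _ subspace_span] \<pi>(3) by blast
    show "\<pi> u = 0" if "u \<in> U" for u using that by (rule 0)
    have "Vector_Spaces.linear scale scale (\<lambda>p. p - \<pi> p)"
      by (intro pair.linear_compose_sub linear_ident \<pi>(1))
    then have sub: "subspace {p. p - \<pi> p \<in> U}"
      by (rule pair.linear_subspace_linear_preimage[OF _ U])
    have "B \<subseteq> {p. p - \<pi> p \<in> U}"
    proof
      fix b assume "b \<in> B"
      then show "b \<in> {p. p - \<pi> p \<in> U}"
        using \<pi>(2) A(1) subspace_0[OF U] by (auto simp: f_def)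
    qed
    then have "span B \<subseteq> {p. p - \<pi> p \<in> U}" using sub by (rule span_minimal)
    moreover have "U \<union> S \<subseteq> span B"
      using A(3) span_mono[OF B(1)] B(4) by blast
    ultimately show "p - \<pi> p \<in> U" if "p \<in> span (U \<union> S)" for p
      using that span_minimal[OF _ subspace_span] by blast
  qed
qed

end

text \<open>The residue class of 0 is represented by zero coefficients, and uniqueness allows no
  others.\<close>

lemma quotient_basis_span_Int:
  assumes V: "vs.subspace V" and W: "vs.subspace W" and q: "quotient_basis V W B"
    and p: "(\<Sum>b\<in>B. scale (u b) b) \<in> W" and b: "b \<in> B"
  shows "u b = 0"
proof -
  define P where "P c \<longleftrightarrow> (\<forall>b. b \<notin> B \<longrightarrow> c b = 0) \<and> 0 - (\<Sum>b\<in>B. scale (c b) b) \<in> W" for c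
  have "\<exists>!c. P c" using q vs.subspace_0[OF V] unfolding quotient_basis_def P_def by blast
  moreover have "P (\<lambda>_. 0)" using vs.subspace_0[OF W] by (simp add: P_def)
  moreover have "P (\<lambda>b. if b \<in> B then u b else 0)"
    using vs.subspace_neg[OF W p] by (simp add: P_def)
  ultimately have "(\<lambda>b. if b \<in> B then u b else 0) = (\<lambda>_. 0)" by blast
  from fun_cong[OF this, of b] b show ?thesis by simp
qed

lemma
  assumes "vs.subspace V" "vs.subspace W" "quotient_basis V W B"
  shows quotient_basis_independent: "vs.independent B"
    and quotient_basis_Int: "vs.span B \<inter> W \<subseteq> {0}"
    and quotient_basis_cover: "p \<in> V \<Longrightarrow> \<exists>b\<in>vs.span B. p - b \<in> W"
proof -
  have fin: "finite B" using assms(3) by (simp add: quotient_basis_def)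
  show "vs.independent B"
    using vs.subspace_0[OF assms(2)]
    by (intro vs.independent_if_scalars_zero fin quotient_basis_span_Int[OF assms]) simp_all
  show "vs.span B \<inter> W \<subseteq> {0}"
  proof
    fix p assume p: "p \<in> vs.span B \<inter> W"
    then obtain u where u: "p = (\<Sum>b\<in>B. scale (u b) b)" unfolding vs.span_finite[OF fin] by blast
    have "scale (u b) b = 0" if "b \<in> B" for b
      using quotient_basis_span_Int[OF assms _ that, of u] p u by simp
    then show "p \<in> {0}" unfolding u by (simp add: sum.neutral)
  qed
  show "\<exists>b\<in>vs.span B. p - b \<in> W" if "p \<in> V"
    using assms(3) that fin unfolding quotient_basis_def vs.span_finite[OF fin] by blast
qed

lemma quotient_basisI:
  assumes W: "vs.subspace W" and B: "finite B" "B \<subseteq> V" "vs.independent B" "vs.span B \<inter> W \<subseteq> {0}"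
    and cover: "\<And>p. p \<in> V \<Longrightarrow> \<exists>b\<in>vs.span B. p - b \<in> W"
  shows "quotient_basis V W B"
  unfolding quotient_basis_def
proof (intro conjI ballI)
  fix p assume "p \<in> V"
  then obtain u where u: "p - (\<Sum>b\<in>B. scale (u b) b) \<in> W"
    using cover unfolding vs.span_finite[OF B(1)] by blast
  show "\<exists>!c. (\<forall>b. b \<notin> B \<longrightarrow> c b = 0) \<and> p - (\<Sum>b\<in>B. scale (c b) b) \<in> W"
  \<comment> \<open>Uniqueness concerns total coefficient functions, so u is cut off to 0 outside
    B.\<close>
  proof (rule ex1I[of _ "\<lambda>b. if b \<in> B then u b else 0"])
    show "(\<forall>b. b \<notin> B \<longrightarrow> (if b \<in> B then u b else 0) = 0) \<and>
      p - (\<Sum>b\<in>B. scale (if b \<in> B then u b else 0) b) \<in> W"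
      using u by simp
  next
    fix c assume c: "(\<forall>b. b \<notin> B \<longrightarrow> c b = 0) \<and> p - (\<Sum>b\<in>B. scale (c b) b) \<in> W"
    let ?d = "\<Sum>b\<in>B. scale (c b - u b) b"
    have "?d = (p - (\<Sum>b\<in>B. scale (u b) b)) - (p - (\<Sum>b\<in>B. scale (c b) b))"
      by (simp add: vs.scale_left_diff_distrib sum_subtractf)
    also have "\<dots> \<in> W" using c by (intro vs.subspace_diff[OF W u]) blast
    finally have "?d \<in> W" .
    moreover have "?d \<in> vs.span B"
      by (intro vs.span_sum vs.span_scale vs.span_base)
    ultimately have "?d = 0" using B(4) by blast
    then have "c b - u b = 0" if "b \<in> B" for b
      using vs.independentD[OF B(3,1) order_refl _ that, of "\<lambda>b. c b - u b"] by simp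
    then show "c = (\<lambda>b. if b \<in> B then u b else 0)" using c by (intro ext) simp
  qed
qed (use B in auto)

text \<open>Projecting along W into span B is injective on span S, because an element of its kernel
  lies in W. Thus S embeds as an independent set into a space spanned by B. S may be infinite
  beforehand; its finiteness is part of the gain.\<close>

lemma quotient_basis_card_bound:
  assumes V: "vs.subspace V" and W: "vs.subspace W" and q: "quotient_basis V W B"
    and S: "S \<subseteq> V" "vs.independent S" "vs.span S \<inter> W \<subseteq> {0}"
  shows "finite S \<and> card S \<le> card B"
proof -
  have fin: "finite B" using q by (simp add: quotient_basis_def)
  obtain \<pi> where \<pi>: "Vector_Spaces.linear scale scale \<pi>" "\<And>p. \<pi> p \<in> vs.span B"
    "\<And>p. p \<in> vs.span (W \<union> B) \<Longrightarrow> p - \<pi> p \<in> W"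
    using vs.projection_along[OF W, of B] by (elim exE conjE) simp
  have cover: "p \<in> vs.span (W \<union> B)" if p: "p \<in> V" for p
  proof -
    obtain b where "b \<in> vs.span B" "p - b \<in> W"
      using quotient_basis_cover[OF V W q p] by blast
    then have "p - b + b \<in> vs.span (W \<union> B)"
      using vs.span_mono[of B "W \<union> B"] by (intro vs.span_add) (auto intro: vs.span_base)
    then show ?thesis by simp
  qed
  have "vs.span S \<subseteq> V" using S(1) V by (rule vs.span_minimal)
  have "p = 0" if p: "p \<in> vs.span S" "\<pi> p = 0" for p
  proof -
    have "p - \<pi> p \<in> W"
      using cover[of p] p(1) \<open>vs.span S \<subseteq> V\<close> by (intro \<pi>(3)) blast
    then show ?thesis using p S(3) by auto
  qed
  then have inj: "inj_on \<pi> (vs.span S)"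
    unfolding vsp.linear_inj_on_iff_eq_0[OF \<pi>(1) vs.subspace_span] by blast
  have "vs.independent (\<pi> ` S)"
    by (rule vsp.linear_independent_injective_image[OF \<pi>(1) S(2) inj])
  then have "finite (\<pi> ` S) \<and> card (\<pi> ` S) \<le> card B"
    using fin \<pi>(2) by (intro vs.independent_span_bound) auto
  moreover have "inj_on \<pi> S" using inj vs.span_superset by (rule inj_on_subset)
  ultimately show ?thesis by (simp add: finite_image_iff card_image)
qed

lemma quotient_dim_eq:
  assumes V: "vs.subspace V" and W: "vs.subspace W" and q: "quotient_basis V W B"
  shows "quotient_dim V W = card B"
  unfolding quotient_dim_def
proof (rule the_equality)
  have le: "card B' \<le> card B''" if "quotient_basis V W B'" "quotient_basis V W B''" for B' B''
    using quotient_basis_card_bound[OF V W that(2)] quotient_basis_independent[OF V W that(1)]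
      quotient_basis_Int[OF V W that(1)] that(1) by (simp add: quotient_basis_def)
  fix m assume "\<exists>B'. quotient_basis V W B' \<and> card B' = m"
  then obtain B' where "quotient_basis V W B'" "card B' = m" by blast
  then show "m = card B" using le[of B' B] le[of B B'] q by simp
qed (use q in blast)

section \<open>Leading terms\<close>

locale dc_ordering =
  fixes \<sigma> :: "'n::finite monom rel"
  assumes dc: "degree_compatible_ordering \<sigma>"
begin

lemma ord_linear: "linear_order \<sigma>"
  using dc by (simp add: degree_compatible_ordering_def term_ordering_def)

lemma ord_refl: "(s, s) \<in> \<sigma>"
  using ord_linear unfolding linear_order_on_def partial_order_on_def preorder_on_def
    refl_on_def by blast

lemma ord_total: "(s, t) \<in> \<sigma> \<or> (t, s) \<in> \<sigma>"
proof (cases "s = t")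
  case False
  have "total \<sigma>" using ord_linear by (simp add: linear_order_on_def)
  then show ?thesis using False by (simp add: total_on_def)
qed (simp add: ord_refl)

lemma ord_antisym: "(s, t) \<in> \<sigma> \<Longrightarrow> (t, s) \<in> \<sigma> \<Longrightarrow> s = t"
  and ord_trans: "(s, t) \<in> \<sigma> \<Longrightarrow> (t, u) \<in> \<sigma> \<Longrightarrow> (s, u) \<in> \<sigma>"
  using ord_linear unfolding linear_order_on_def partial_order_on_def preorder_on_def
  by (auto dest: antisymD transD)

lemma ord_add: "(s, t) \<in> \<sigma> \<Longrightarrow> (u + s, u + t) \<in> \<sigma>"
  using dc unfolding degree_compatible_ordering_def term_ordering_def add.commute[of u] by blast

lemma ord_mdeg: "(s, t) \<in> \<sigma> \<Longrightarrow> mdeg s \<le> mdeg t"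
  using dc by (simp add: degree_compatible_ordering_def)

text \<open>Degree compatibility bounds the degree of everything below t. The size of this initial
  segment is the induction measure for reductions.\<close>

lemma finite_below: "finite {s. (s, t) \<in> \<sigma>}"
  by (rule finite_subset[OF _ finite_monoms_le[of "mdeg t"]]) (auto simp: monoms_le_def ord_mdeg)

lemma ord_greatest:
  assumes "finite S" "S \<noteq> {}"
  obtains t where "t \<in> S" "\<And>s. s \<in> S \<Longrightarrow> (s, t) \<in> \<sigma>"
proof -
  from assms have "\<exists>t\<in>S. \<forall>s\<in>S. (s, t) \<in> \<sigma>"
  proof (induction S rule: finite_ne_induct)
    case (singleton x)
    then show ?case by (simp add: ord_refl)
  next
    case (insert x S)
    then obtain t where t: "t \<in> S" "\<forall>s\<in>S. (s, t) \<in> \<sigma>" by blast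
    show ?case
    proof (cases "(x, t) \<in> \<sigma>")
      case True
      with t show ?thesis by blast
    next
      case False
      then have "(t, x) \<in> \<sigma>" using ord_total by blast
      then have "\<forall>s\<in>insert x S. (s, x) \<in> \<sigma>" using t ord_trans ord_refl by blast
      then show ?thesis by blast
    qed
  qed
  then show thesis using that by blast
qed

lemma LT_eqI:
  assumes "t \<in> keys p" "\<And>s. s \<in> keys p \<Longrightarrow> (s, t) \<in> \<sigma>"
  shows "LT \<sigma> p = t"
  unfolding LT_def using assms ord_antisym by (intro the_equality) auto

lemma
  assumes "p \<noteq> 0"
  shows LT_in_keys: "LT \<sigma> p \<in> keys p"
    and keys_le_LT: "s \<in> keys p \<Longrightarrow> (s, LT \<sigma> p) \<in> \<sigma>"
proof -
  have "keys p \<noteq> {}" using assms by simp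
  then obtain t where t: "t \<in> keys p" "\<And>s. s \<in> keys p \<Longrightarrow> (s, t) \<in> \<sigma>"
    using ord_greatest[OF finite_keys] by blast
  then have "LT \<sigma> p = t" by (rule LT_eqI)
  with t show "LT \<sigma> p \<in> keys p" "s \<in> keys p \<Longrightarrow> (s, LT \<sigma> p) \<in> \<sigma>" by auto
qed

lemma LT_mon [simp]: "LT \<sigma> (mon t :: ('n, 'a::field) mpoly) = t"
  by (rule LT_eqI) (auto simp: ord_refl)

lemma LT_mon_mult:
  assumes "p \<noteq> 0"
  shows "mon s * p \<noteq> 0" "LT \<sigma> (mon s * p) = s + LT \<sigma> p"
proof -
  have in_keys: "s + LT \<sigma> p \<in> keys (mon s * p)"
    using LT_in_keys[OF assms] by (simp add: keys_mon_mult)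
  then show "mon s * p \<noteq> 0" by (metis keys_zero empty_iff)
  show "LT \<sigma> (mon s * p) = s + LT \<sigma> p"
    using in_keys by (rule LT_eqI) (auto simp: keys_mon_mult intro: ord_add keys_le_LT[OF assms])
qed

abbreviation mons_upto :: "int \<Rightarrow> 'n monom set" where
  "mons_upto k \<equiv> {t. int (mdeg t) \<le> k}"

text \<open>By degree compatibility the leading term has the largest degree in the support, so it
  alone decides about degree bounds.\<close>

lemma in_mons_upto_span_iff:
  assumes "p \<noteq> 0"
  shows "p \<in> mono_span (mons_upto k) \<longleftrightarrow> int (mdeg (LT \<sigma> p)) \<le> k"
proof
  assume "p \<in> mono_span (mons_upto k)"
  then show "int (mdeg (LT \<sigma> p)) \<le> k"
    using LT_in_keys[OF assms] unfolding in_mono_span_iff by blast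
next
  assume k: "int (mdeg (LT \<sigma> p)) \<le> k"
  have "int (mdeg s) \<le> k" if "s \<in> keys p" for s
    using ord_mdeg[OF keys_le_LT[OF assms that]] k by linarith
  then show "p \<in> mono_span (mons_upto k)" unfolding in_mono_span_iff by blast
qed

section \<open>Triangular families\<close>

text \<open>Among the summands with nonzero coefficient take the greatest leading term t. The
  leading terms differ, so t occurs in the support of only one of these summands and cannot
  cancel.\<close>

lemma LT_sum:
  assumes B: "finite B" "0 \<notin> B" "inj_on (LT \<sigma>) B" and nz: "b \<in> B" "u b \<noteq> 0"
  shows "(\<Sum>b\<in>B. scale (u b) b) \<noteq> 0" "LT \<sigma> (\<Sum>b\<in>B. scale (u b) b) \<in> LT \<sigma> ` B"
proof -
  let ?p = "\<Sum>b\<in>B. scale (u b) b"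
  let ?B = "{b\<in>B. u b \<noteq> 0}"
  have "finite (LT \<sigma> ` ?B)" "LT \<sigma> ` ?B \<noteq> {}" using B(1) nz by auto
  then obtain t where t: "t \<in> LT \<sigma> ` ?B" "\<And>s. s \<in> LT \<sigma> ` ?B \<Longrightarrow> (s, t) \<in> \<sigma>"
    using ord_greatest by blast
  then obtain b0 where b0: "b0 \<in> B" "u b0 \<noteq> 0" "LT \<sigma> b0 = t" by blast
  have le: "(s, t) \<in> \<sigma>" if "b \<in> B" "u b \<noteq> 0" "s \<in> keys b" for b s
  proof -
    have "b \<noteq> 0" using B(2) that(1) by blast
    then have "(s, LT \<sigma> b) \<in> \<sigma>" using that(3) by (rule keys_le_LT)
    moreover have "(LT \<sigma> b, t) \<in> \<sigma>" using t(2) that by blast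
    ultimately show ?thesis by (rule ord_trans)
  qed
  have zero: "u b * lookup b t = 0" if "b \<in> B" "b \<noteq> b0" for b
  proof (rule ccontr)
    assume "u b * lookup b t \<noteq> 0"
    then have ub: "u b \<noteq> 0" "t \<in> keys b" by (auto simp: in_keys_iff)
    have "b \<noteq> 0" using B(2) that(1) by blast
    then have "(t, LT \<sigma> b) \<in> \<sigma>" using ub(2) by (rule keys_le_LT)
    moreover have "(LT \<sigma> b, t) \<in> \<sigma>" using t(2) that ub by blast
    ultimately have "LT \<sigma> b = LT \<sigma> b0" using ord_antisym b0(3) by blast
    then show False using B(3) that b0(1) by (auto dest: inj_onD)
  qed
  have "lookup ?p t = (\<Sum>b\<in>B. u b * lookup b t)" by (simp add: lookup_sum)
  also have "\<dots> = u b0 * lookup b0 t"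
    using sum.remove[OF B(1) b0(1), of "\<lambda>b. u b * lookup b t"] zero by simp
  also have "\<dots> \<noteq> 0"
  proof -
    have "b0 \<noteq> 0" using B(2) b0(1) by blast
    from LT_in_keys[OF this] b0 show ?thesis by (simp add: in_keys_iff)
  qed
  finally have tk: "t \<in> keys ?p" by (simp add: in_keys_iff)
  then show "?p \<noteq> 0" by (metis keys_zero empty_iff)
  have "(s, t) \<in> \<sigma>" if "s \<in> keys ?p" for s
  proof -
    have "(\<Sum>b\<in>B. u b * lookup b s) \<noteq> 0" using that by (simp add: in_keys_iff lookup_sum)
    then obtain b where "b \<in> B" "u b * lookup b s \<noteq> 0" by (meson sum.not_neutral_contains_not_neutral)
    then show ?thesis using le[of b s] by (simp add: in_keys_iff)
  qed
  with tk have "LT \<sigma> ?p = t" by (rule LT_eqI)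
  then show "LT \<sigma> ?p \<in> LT \<sigma> ` B" using imageI[OF b0(1), of "LT \<sigma>"] b0(3) by simp
qed

lemma independent_LT:
  assumes "0 \<notin> B" "inj_on (LT \<sigma>) B"
  shows "vs.independent B"
  unfolding vs.independent_explicit_module
proof (intro allI impI, rule ccontr)
  fix t u v
  assume t: "finite t" "t \<subseteq> B" "(\<Sum>v\<in>t. scale (u v) v) = 0" "v \<in> t" "u v \<noteq> 0"
  moreover have "0 \<notin> t" "inj_on (LT \<sigma>) t" using assms t(2) by (auto intro: inj_on_subset)
  ultimately show False using LT_sum(1)[of t v u] by blast
qed

lemma LT_span:
  assumes B: "0 \<notin> B" "inj_on (LT \<sigma>) B" and p: "p \<in> vs.span B" "p \<noteq> 0"
  shows "LT \<sigma> p \<in> LT \<sigma> ` B"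
proof -
  obtain t u where t: "p = (\<Sum>v\<in>t. scale (u v) v)" "finite t" "t \<subseteq> B"
    using p(1) unfolding vs.span_explicit by blast
  have "\<exists>v\<in>t. u v \<noteq> 0"
  proof (rule ccontr)
    assume "\<not> ?thesis"
    then have "p = 0" unfolding t(1) by (intro sum.neutral) simp
    then show False using p(2) by simp
  qed
  then obtain v where "v \<in> t" "u v \<noteq> 0" by blast
  moreover have "0 \<notin> t" "inj_on (LT \<sigma>) t" using B t(3) by (auto intro: inj_on_subset)
  ultimately have "LT \<sigma> p \<in> LT \<sigma> ` t" using LT_sum(2)[of t v u] t by blast
  then show ?thesis using t(3) by blast
qed

text \<open>Subtracting the right multiple of the member of w with the same leading term gives 0 or
  strictly lowers the leading term.\<close>

lemma triangular_spans:
  assumes w: "\<And>t. w t \<noteq> 0" "\<And>t. LT \<sigma> (w t) = t"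
  shows "p \<noteq> 0 \<Longrightarrow> p \<in> vs.span (w ` {s. (s, LT \<sigma> p) \<in> \<sigma>})"
proof (induction "card {s. (s, LT \<sigma> p) \<in> \<sigma>}" arbitrary: p rule: less_induct)
  case less
  define t where "t = LT \<sigma> p"
  \<comment> \<open>\<open>w t\<close> need not be monic, hence the division by its leading
    coefficient.\<close>
  define c where "c = lookup p t / lookup (w t) t"
  define q where "q = p - scale c (w t)"
  have wt: "w t \<in> vs.span (w ` {s. (s, t) \<in> \<sigma>})"
    by (rule vs.span_base) (auto simp: ord_refl)
  have "lookup (w t) t \<noteq> 0" using LT_in_keys[OF w(1), of t] w(2) by (simp add: in_keys_iff)
  then have qt: "lookup q t = 0" by (simp add: q_def c_def lookup_minus)
  have "q \<in> vs.span (w ` {s. (s, t) \<in> \<sigma>})"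
  proof (cases "q = 0")
    case False
    have le: "(LT \<sigma> q, t) \<in> \<sigma>"
    proof -
      have "LT \<sigma> q \<in> keys p \<or> LT \<sigma> q \<in> keys (w t)"
        using LT_in_keys[OF False] by (auto simp: in_keys_iff q_def lookup_minus)
      then show ?thesis
        using keys_le_LT[OF less.prems] keys_le_LT[OF w(1), of _ t] by (auto simp: t_def w(2))
    qed
    have ne: "LT \<sigma> q \<noteq> t" using LT_in_keys[OF False] qt by (auto simp: in_keys_iff)
    have sub: "{s. (s, LT \<sigma> q) \<in> \<sigma>} \<subseteq> {s. (s, t) \<in> \<sigma>}" using le ord_trans by blast
    moreover have "t \<notin> {s. (s, LT \<sigma> q) \<in> \<sigma>}" using le ne ord_antisym by blast
    moreover have "t \<in> {s. (s, t) \<in> \<sigma>}" by (simp add: ord_refl)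
    ultimately have "card {s. (s, LT \<sigma> q) \<in> \<sigma>} < card {s. (s, t) \<in> \<sigma>}"
      by (intro psubset_card_mono finite_below) blast
    then have "q \<in> vs.span (w ` {s. (s, LT \<sigma> q) \<in> \<sigma>})"
      using less.hyps False by (simp add: t_def)
    then show ?thesis using vs.span_mono[OF image_mono[OF sub]] by blast
  qed (simp add: vs.span_zero)
  then have "q + scale c (w t) \<in> vs.span (w ` {s. (s, t) \<in> \<sigma>})"
    using wt by (intro vs.span_add vs.span_scale)
  then show ?case by (simp add: q_def t_def)
qed

lemma triangular_spans_upto:
  assumes w: "\<And>t. w t \<noteq> 0" "\<And>t. LT \<sigma> (w t) = t" and p: "p \<in> mono_span (mons_upto k)"
  shows "p \<in> vs.span (w ` mons_upto k)"
proof (cases "p = 0")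
  case False
  have "{s. (s, LT \<sigma> p) \<in> \<sigma>} \<subseteq> mons_upto k"
    using p ord_mdeg unfolding in_mons_upto_span_iff[OF False] by fastforce
  then show ?thesis using vs.span_mono[OF image_mono] triangular_spans[OF w False] by blast
qed (simp add: vs.span_zero)

section \<open>Leading terms of a subspace and division with remainder\<close>

text \<open>The zero polynomial is removed because \<open>LT\<close> has an unspecified value
  there.\<close>

definition LTs :: "('n, 'a::field) mpoly set \<Rightarrow> 'n monom set" where
  "LTs U = LT \<sigma> ` (U - {0})"

definition lead_rep :: "('n, 'a::field) mpoly set \<Rightarrow> 'n monom \<Rightarrow> ('n, 'a) mpoly" where
  "lead_rep U t = (SOME p. p \<in> U - {0} \<and> LT \<sigma> p = t)"

lemma lead_rep:
  assumes "t \<in> LTs U"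
  shows "lead_rep U t \<in> U" "lead_rep U t \<noteq> 0" "LT \<sigma> (lead_rep U t) = t"
proof -
  have "\<exists>p. p \<in> U - {0} \<and> LT \<sigma> p = t" using assms by (auto simp: LTs_def)
  from someI_ex[OF this]
  show "lead_rep U t \<in> U" "lead_rep U t \<noteq> 0" "LT \<sigma> (lead_rep U t) = t"
    unfolding lead_rep_def by auto
qed

lemma LTs_I: "p \<in> U \<Longrightarrow> p \<noteq> 0 \<Longrightarrow> LT \<sigma> p \<in> LTs U"
  by (auto simp: LTs_def)

lemma inj_lead_rep: "S \<subseteq> LTs U \<Longrightarrow> inj_on (lead_rep U) S"
  by (rule inj_onI) (metis lead_rep(3) subsetD)

lemma lead_rep_image:
  assumes "S \<subseteq> LTs U"
  shows "lead_rep U ` S \<subseteq> U" "0 \<notin> lead_rep U ` S" "inj_on (LT \<sigma>) (lead_rep U ` S)"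
    "LT \<sigma> ` lead_rep U ` S = S"
proof -
  show "lead_rep U ` S \<subseteq> U" using assms lead_rep(1) by blast
  show "0 \<notin> lead_rep U ` S" using assms lead_rep(2) by (metis imageE subsetD)
  have eq: "LT \<sigma> (lead_rep U t) = t" if "t \<in> S" for t using that assms lead_rep(3) by blast
  then show "inj_on (LT \<sigma>) (lead_rep U ` S)" by (auto intro!: inj_onI)
  show "LT \<sigma> ` lead_rep U ` S = S" using eq by (simp add: image_image)
qed

lemma mono_span_compl_Int:
  assumes "p \<in> U" "p \<in> mono_span (- LTs U)"
  shows "p = 0"
proof (rule ccontr)
  assume "p \<noteq> 0"
  then have "LT \<sigma> p \<in> LTs U" "LT \<sigma> p \<in> keys p" using assms(1) LTs_I LT_in_keys by auto
  then show False using assms(2) unfolding in_mono_span_iff by blast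
qed

text \<open>The family w takes an element of U where one with that leading term exists and the
  monomial itself otherwise. Every monomial is then a leading term exactly once, and reduction by w
  is division with remainder that respects the degree bound.\<close>

lemma LTs_decomposition:
  assumes p: "p \<in> mono_span (mons_upto k)"
  obtains q r where "p = q + r" "q \<in> vs.span (lead_rep U ` (mons_upto k \<inter> LTs U))"
    "r \<in> mono_span (mons_upto k - LTs U)"
proof -
  define w where "w t = (if t \<in> LTs U then lead_rep U t else mon t)" for t
  have w: "w t \<noteq> 0" "LT \<sigma> (w t) = t" for t
    using lead_rep[of t U] by (auto simp: w_def)
  have "w ` mons_upto k = w ` (mons_upto k \<inter> LTs U) \<union> w ` (mons_upto k - LTs U)"
    by blast
  also have "w ` (mons_upto k \<inter> LTs U) = lead_rep U ` (mons_upto k \<inter> LTs U)"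
    by (rule image_cong) (simp_all add: w_def)
  also have "w ` (mons_upto k - LTs U) = mon ` (mons_upto k - LTs U)"
    by (rule image_cong) (simp_all add: w_def)
  finally have "p \<in> vs.span (lead_rep U ` (mons_upto k \<inter> LTs U) \<union> mon ` (mons_upto k - LTs U))"
    using triangular_spans_upto[OF w p] by simp
  then show thesis unfolding vs.span_Un mono_span_def[symmetric] using that by blast
qed

text \<open>For an element of U the remainder of the division lies in U as well, and its support
  avoids all leading terms of U, so it is 0.\<close>

lemma span_lead_rep:
  assumes U: "vs.subspace U"
  shows "vs.span (lead_rep U ` (mons_upto k \<inter> LTs U)) = U \<inter> mono_span (mons_upto k)"
proof
  have "lead_rep U t \<in> mono_span (mons_upto k)" if "t \<in> mons_upto k \<inter> LTs U" for t
    using that lead_rep[of t U] in_mons_upto_span_iff[of "lead_rep U t" k] by simp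
  then show "vs.span (lead_rep U ` (mons_upto k \<inter> LTs U)) \<subseteq> U \<inter> mono_span (mons_upto k)"
    using lead_rep_image(1)[of "mons_upto k \<inter> LTs U" U]
    by (intro vs.span_minimal vs.subspace_inter U subspace_mono_span) auto
  show "U \<inter> mono_span (mons_upto k) \<subseteq> vs.span (lead_rep U ` (mons_upto k \<inter> LTs U))"
  proof
    fix p assume p: "p \<in> U \<inter> mono_span (mons_upto k)"
    then obtain q r where qr: "p = q + r" "q \<in> vs.span (lead_rep U ` (mons_upto k \<inter> LTs U))"
      "r \<in> mono_span (mons_upto k - LTs U)"
      using LTs_decomposition by blast
    have "q \<in> U"
      using qr(2) vs.span_minimal[OF lead_rep_image(1) U] by blast
    then have "p - q \<in> U" using p U by (intro vs.subspace_diff) auto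
    then have "r \<in> U" using qr(1) by simp
    moreover have "r \<in> mono_span (- LTs U)"
      using qr(3) mono_span_mono[of "mons_upto k - LTs U" "- LTs U"] by auto
    ultimately have "r = 0" by (rule mono_span_compl_Int)
    then show "p \<in> vs.span (lead_rep U ` (mons_upto k \<inter> LTs U))" using qr by simp
  qed
qed

lemma monoms_le_eq: "monoms_le d = mons_upto (int d)"
  by (simp add: monoms_le_def)

lemma finite_mons_upto: "finite (mons_upto k)"
  by (rule finite_subset[OF _ finite_monoms_le[of "nat k"]]) (auto simp: monoms_le_def)

text \<open>One representative for each leading term suffices. This is what makes step (2)
  executable.\<close>

lemma triangular_basis_exists:
  assumes U: "vs.subspace U" "U \<subseteq> mono_span (monoms_le d)"
  obtains V where "vs.independent V" "vs.span V = U" "inj_on (LT \<sigma>) V"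
proof -
  let ?V = "lead_rep U ` (mons_upto (int d) \<inter> LTs U)"
  have sub: "mons_upto (int d) \<inter> LTs U \<subseteq> LTs U" by blast
  show thesis
  proof (rule that)
    show "vs.independent ?V"
      by (rule independent_LT[OF lead_rep_image(2,3)[OF sub]])
    show "vs.span ?V = U" unfolding span_lead_rep[OF U(1)] using U(2) by (auto simp: monoms_le_eq)
    show "inj_on (LT \<sigma>) ?V" by (rule lead_rep_image(3)[OF sub])
  qed
qed

text \<open>The representatives whose leading term has degree exactly k form a basis of the
  quotient, so \<open>degree_compatible\<close> turns into counting leading terms.\<close>

lemma quotient_dim_ideal_le:
  assumes U: "vs.subspace U"
  shows "quotient_dim (ideal_le U k) (ideal_le U (k - 1)) = card {t \<in> LTs U. int (mdeg t) = k}"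
proof -
  let ?T = "{t \<in> LTs U. int (mdeg t) = k}"
  let ?B = "lead_rep U ` ?T"
  have sub: "?T \<subseteq> LTs U" by blast
  note rep = lead_rep_image[OF sub]
  have sp: "vs.subspace (ideal_le U j)" for j
    unfolding ideal_le_eq by (intro vs.subspace_inter U subspace_mono_span)
  have split: "mons_upto k \<inter> LTs U = ?T \<union> (mons_upto (k - 1) \<inter> LTs U)" by auto
  have fin: "finite ?T" by (rule finite_subset[OF _ finite_mons_upto[of k]]) auto
  have "quotient_basis (ideal_le U k) (ideal_le U (k - 1)) ?B"
  proof (rule quotient_basisI[OF sp])
    show "finite ?B" using fin by simp
    show "vs.independent ?B" by (rule independent_LT[OF rep(2,3)])
    have "?B \<subseteq> lead_rep U ` (mons_upto k \<inter> LTs U)" by (rule image_mono) auto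
    then show "?B \<subseteq> ideal_le U k"
      unfolding ideal_le_eq span_lead_rep[OF U, symmetric] using vs.span_superset by blast
    show "vs.span ?B \<inter> ideal_le U (k - 1) \<subseteq> {0}"
    proof
      fix p assume p: "p \<in> vs.span ?B \<inter> ideal_le U (k - 1)"
      have False if "p \<noteq> 0"
      proof -
        have "LT \<sigma> p \<in> ?T" using LT_span[OF rep(2,3)] p that rep(4) by blast
        moreover have "int (mdeg (LT \<sigma> p)) \<le> k - 1"
          using p in_mons_upto_span_iff[OF that, of "k - 1"] unfolding ideal_le_eq by blast
        ultimately show False by simp
      qed
      then show "p \<in> {0}" by blast
    qed
    show "\<exists>b\<in>vs.span ?B. p - b \<in> ideal_le U (k - 1)" if "p \<in> ideal_le U k" for p
    proof -
      have "p \<in> vs.span (lead_rep U ` (mons_upto k \<inter> LTs U))"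
        using that unfolding span_lead_rep[OF U] ideal_le_eq .
      then obtain b c where "p = b + c" "b \<in> vs.span ?B"
        "c \<in> vs.span (lead_rep U ` (mons_upto (k - 1) \<inter> LTs U))"
        unfolding split image_Un vs.span_Un by blast
      then show ?thesis unfolding span_lead_rep[OF U] ideal_le_eq by (intro bexI[of _ b]) auto
    qed
  qed
  then have "quotient_dim (ideal_le U k) (ideal_le U (k - 1)) = card ?B"
    by (rule quotient_dim_eq[OF sp sp])
  then show ?thesis by (simp add: card_image inj_lead_rep[OF sub])
qed

end

section \<open>Border bases\<close>

lemma poly_expand_superset:
  assumes "finite S" "keys p \<subseteq> S"
  shows "(\<Sum>t\<in>S. scale (lookup p t) (mon t)) = p"
proof -
  have "(\<Sum>t\<in>keys p. scale (lookup p t) (mon t)) = (\<Sum>t\<in>S. scale (lookup p t) (mon t))"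
  proof (rule sum.mono_neutral_left[OF assms])
    show "\<forall>t\<in>S - keys p. scale (lookup p t) (mon t) = 0" by (simp add: in_keys_iff)
  qed
  then show ?thesis by (simp only: poly_expand)
qed

lemma order_ideal_zero: "order_ideal \<O> \<Longrightarrow> \<O> \<noteq> {} \<Longrightarrow> 0 \<in> \<O>"
  unfolding order_ideal_def by (metis add_0 ex_in_conv)

text \<open>The space M = J + <O> contains 1 and is closed under multiplication by an indeterminate:
  J is an ideal, and x_j s with s in O is either in O or a border monomial, which J rewrites into
  <O>. Hence M is everything.\<close>

lemma border_prebasis_spans:
  fixes J :: "('n::finite, 'a::field) mpoly set"
  assumes O: "order_ideal \<O>" and J: "ring.subspace J"
    and g: "\<And>b. b \<in> border \<O> \<Longrightarrow> \<exists>r\<in>mono_span \<O>. mon b - r \<in> J"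
  shows "\<exists>q\<in>J. \<exists>r\<in>mono_span \<O>. p = q + r"
proof -
  define M where "M = {q + r | q r. q \<in> J \<and> r \<in> mono_span \<O>}"
  have M: "vs.subspace M"
    unfolding M_def by (intro vs.subspace_sums ring_subspace_imp_subspace J subspace_mono_span)
  have JM: "q \<in> M" if "q \<in> J" for q
    unfolding M_def using that vs.subspace_0[OF subspace_mono_span, of \<O>]
    by (intro CollectI exI[of _ q] exI[of _ 0]) simp
  have OM: "mon s \<in> M" if "s \<in> \<O>" for s
    unfolding M_def using that ring.subspace_0[OF J]
    by (intro CollectI exI[of _ 0] exI[of _ "mon s"]) simp
  have bM: "mon b \<in> M" if "b \<in> border \<O>" for b
  proof -
    obtain r where "r \<in> mono_span \<O>" "mon b - r \<in> J" using g \<open>b \<in> border \<O>\<close> by blast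
    then show ?thesis
      unfolding M_def by (intro CollectI exI[of _ "mon b - r"] exI[of _ r]) simp
  qed
  have "mon t \<in> M" for t
  proof (induction t rule: monom_induct)
    case zero
    show ?case
    proof (cases "\<O> = {}")
      \<comment> \<open>The convention that the empty order ideal has border {1} supplies the start
        of the induction here.\<close>
      case True
      then show ?thesis by (intro bM) (simp add: border_def)
    next
      case False
      then show ?thesis using OM order_ideal_zero[OF O] by blast
    qed
  next
    case (step j t)
    then obtain q r where qr: "mon t = q + r" "q \<in> J" "r \<in> mono_span \<O>" unfolding M_def by blast
    have "mon (ind j) * q \<in> M" by (rule JM) (rule ring.subspace_scale[OF J qr(2)])
    moreover have "mon (ind j) * r \<in> M"
    proof -
      have "mon (ind j) * r = (\<Sum>s\<in>keys r. scale (lookup r s) (mon (ind j + s)))"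
        using arg_cong[OF poly_expand[of r], of "(*) (mon (ind j))"]
        by (simp add: sum_distrib_left scale_mult_right mon_add)
      also have "\<dots> \<in> M"
      proof (intro vs.subspace_sum vs.subspace_scale M)
        fix s assume "s \<in> keys r"
        then have s: "s \<in> \<O>" using qr(3) unfolding in_mono_span_iff by blast
        show "mon (ind j + s) \<in> M"
        proof (cases "ind j + s \<in> \<O>")
          case False
          then have "ind j + s \<in> border \<O>" using s unfolding border_def by auto
          then show ?thesis by (rule bM)
        qed (rule OM)
      qed
      finally show ?thesis .
    qed
    ultimately have "mon (ind j) * q + mon (ind j) * r \<in> M" by (rule vs.subspace_add[OF M])
    then show ?case by (simp only: mon_add qr(1) distrib_left)
  qed
  then have "(\<Sum>t\<in>keys p. scale (lookup p t) (mon t)) \<in> M"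
    by (intro vs.subspace_sum vs.subspace_scale M)
  then have "p \<in> M" by (simp only: poly_expand)
  then show ?thesis unfolding M_def by blast
qed

text \<open>The ideal generated by the \<open>g b\<close> lies in I and already spans everything
  together with <O>. Since I meets <O> only in 0, it cannot be smaller than I.\<close>

lemma border_basisI:
  fixes I :: "('n::finite, 'a::field) mpoly set"
  assumes O: "order_ideal \<O>" and I: "ring.subspace I" and int: "I \<inter> mono_span \<O> = {0}"
    and g: "\<And>b. b \<in> border \<O> \<Longrightarrow> g b \<in> I \<and> mon b - g b \<in> mono_span \<O>"
  shows "border_basis \<O> I (g ` border \<O>)"
  unfolding border_basis_def
proof (intro conjI allI)
  define \<alpha> where "\<alpha> t b = lookup (mon b - g b) t" for t b
  have "g b = mon b - (\<Sum>t\<in>\<O>. scale (\<alpha> t b) (mon t))" if "b \<in> border \<O>" for b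
  proof -
    have "keys (mon b - g b) \<subseteq> \<O>" using g[OF that] unfolding in_mono_span_iff by blast
    from poly_expand_superset[OF _ this] show ?thesis
      using O by (simp add: \<alpha>_def order_ideal_def)
  qed
  then have "g ` border \<O> = (\<lambda>b. mon b - (\<Sum>t\<in>\<O>. scale (\<alpha> t b) (mon t))) ` border \<O>"
    by (rule image_cong[OF refl])
  then show "\<exists>\<alpha>. g ` border \<O> = (\<lambda>b. mon b - (\<Sum>t\<in>\<O>. scale (\<alpha> t b) (mon t))) ` border \<O>"
    by (intro exI[of _ \<alpha>])
  have sub: "ideal_gen (g ` border \<O>) \<subseteq> I"
    by (rule ideal_gen_minimal[OF _ I]) (use g in blast)
  have cover: "\<exists>q\<in>ideal_gen (g ` border \<O>). \<exists>r\<in>mono_span \<O>. p = q + r" for p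
  proof (rule border_prebasis_spans[OF O subspace_ideal_gen])
    fix b assume b: "b \<in> border \<O>"
    have "g b \<in> ideal_gen (g ` border \<O>)" using b ideal_gen_superset by blast
    then show "\<exists>r\<in>mono_span \<O>. mon b - r \<in> ideal_gen (g ` border \<O>)"
      using g[OF b] by (intro bexI[of _ "mon b - g b"]) simp_all
  qed
  show "ideal_gen (g ` border \<O>) = I"
  proof
    show "I \<subseteq> ideal_gen (g ` border \<O>)"
    proof
      fix p assume p: "p \<in> I"
      obtain q r where qr: "q \<in> ideal_gen (g ` border \<O>)" "r \<in> mono_span \<O>" "p = q + r"
        using cover by blast
      have "p - q \<in> I" by (rule ring.subspace_diff[OF I p]) (use sub qr(1) in blast)
      then have "r \<in> I \<inter> mono_span \<O>" using qr(2,3) by simp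
      then have "r = 0" using int by blast
      then show "p \<in> ideal_gen (g ` border \<O>)" using qr by simp
    qed
  qed (rule sub)
  show "\<exists>q\<in>I. \<exists>r\<in>mono_span \<O>. p = q + r" for p using cover sub by blast
qed (rule int)

lemma border_basis_decomposition:
  assumes "border_basis \<O> I G"
  shows "I \<inter> mono_span \<O> = {0}" "\<exists>q\<in>I. \<exists>r\<in>mono_span \<O>. p = q + r"
  using assms unfolding border_basis_def by blast+

context dc_ordering
begin

section \<open>The leading terms of an ideal and order ideals in Lambda(I)\<close>

lemma LTs_add:
  fixes I :: "('n, 'a::field) mpoly set"
  assumes I: "ring.subspace I" and s: "s \<in> LTs I"
  shows "t + s \<in> LTs I"
proof -
  note r = lead_rep[OF s]
  have "mon t * lead_rep I s \<in> I" by (rule ring.subspace_scale[OF I r(1)])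
  from LTs_I[OF this] LT_mon_mult[OF r(2), of t] r(3) show ?thesis by simp
qed

lemma poly_in_some_upto: "\<exists>k. p \<in> mono_span (mons_upto k)"
  using pdeg_le_iff[of p "int (pdeg p)"] by blast

lemma finite_compl_LTs:
  assumes I: "ring.subspace I" and zd: "zero_dimensional I"
  shows "finite (- LTs I)"
proof -
  obtain B where B: "quotient_basis UNIV I B" using zd by (auto simp: zero_dimensional_def)
  have int: "vs.span (mon ` (- LTs I)) \<inter> I \<subseteq> {0}"
    using mono_span_compl_Int[of _ I] unfolding mono_span_def by blast
  have "finite (mon ` (- LTs I) :: ('n, 'a) mpoly set)"
    using quotient_basis_card_bound[OF vs.subspace_UNIV ring_subspace_imp_subspace[OF I] B subset_UNIV
      independent_mon int] by blast
  then show ?thesis by (rule finite_imageD[OF _ inj_mon])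
qed

lemma mono_span_compl_cover:
  assumes "vs.subspace U"
  shows "\<exists>q\<in>U. \<exists>r\<in>mono_span (- LTs U). p = q + r"
proof -
  obtain k where "p \<in> mono_span (mons_upto k)" using poly_in_some_upto by blast
  then obtain q r where qr: "p = q + r" "q \<in> vs.span (lead_rep U ` (mons_upto k \<inter> LTs U))"
      "r \<in> mono_span (mons_upto k - LTs U)"
    using LTs_decomposition by blast
  have "q \<in> U" using qr(2) unfolding span_lead_rep[OF assms] by blast
  moreover have "r \<in> mono_span (- LTs U)"
    using qr(3) mono_span_mono[of "mons_upto k - LTs U" "- LTs U"] by auto
  ultimately show ?thesis using qr(1) by blast
qed

lemma compl_LTs_in_Lambda:
  fixes I :: "('n, 'a::field) mpoly set"
  assumes I: "ring.subspace I" and zd: "zero_dimensional I"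
  shows "- LTs I \<in> \<Lambda> I"
proof -
  note sI = ring_subspace_imp_subspace[OF I]
  have ord: "order_ideal (- LTs I)"
    unfolding order_ideal_def
  proof (intro conjI allI impI)
    fix s t assume st: "s + t \<in> - LTs I"
    show "s \<in> - LTs I"
    proof
      assume "s \<in> LTs I"
      then have "t + s \<in> LTs I" by (rule LTs_add[OF I])
      then show False using st by (simp add: add.commute)
    qed
  qed (rule finite_compl_LTs[OF I zd])
  \<comment> \<open>After rewriting with \<open>quotient_dim_ideal_le\<close>, compatibility only
    compares a subset of \<open>monoms_eq i\<close> with its complement.\<close>
  have compat: "degree_compatible (- LTs I) I"
    unfolding degree_compatible_def quotient_dim_ideal_le[OF sI]
  proof
    fix i :: nat
    have eq: "{t \<in> LTs I. int (mdeg t) = int i} = monoms_eq i \<inter> LTs I" by (auto simp: monoms_eq_def)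
    have "{t \<in> - LTs I. mdeg t = i} = monoms_eq i - (monoms_eq i \<inter> LTs I)" by (auto simp: monoms_eq_def)
    then have "card {t \<in> - LTs I. mdeg t = i} = card (monoms_eq i :: 'n monom set) - card (monoms_eq i \<inter> LTs I)"
      by (simp add: card_Diff_subset)
    moreover have "card (monoms_eq i \<inter> LTs I) \<le> card (monoms_eq i :: 'n monom set)"
      by (rule card_mono) auto
    ultimately show "int (card {t \<in> - LTs I. mdeg t = i}) = int (card (monoms_eq i :: 'n monom set))
      - int (card {t \<in> LTs I. int (mdeg t) = int i})"
      unfolding eq by simp
  qed
  have "\<exists>q\<in>I. mon b - q \<in> mono_span (- LTs I)" for b
  proof -
    obtain q r where "q \<in> I" "r \<in> mono_span (- LTs I)" "mon b = q + r"
      using mono_span_compl_cover[OF sI, of "mon b"] by blast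
    then show ?thesis by (intro bexI[of _ q]) simp_all
  qed
  then obtain g where g: "\<And>b. g b \<in> I \<and> mon b - g b \<in> mono_span (- LTs I)" by metis
  have int: "I \<inter> mono_span (- LTs I) = {0}"
    using mono_span_compl_Int vs.subspace_0[OF sI] vs.subspace_0[OF subspace_mono_span] by blast
  have "border_basis (- LTs I) I (g ` border (- LTs I))"
    by (rule border_basisI[OF ord I int g])
  with ord compat show ?thesis by (auto simp: \<Lambda>_def)
qed

lemma Lambda_no_top_degree:
  fixes I :: "('n, 'a::field) mpoly set"
  assumes I: "ring.subspace I" and O: "\<O> \<in> \<Lambda> I" and d: "monoms_eq d \<subseteq> LTs I"
    and t: "t \<in> \<O>"
  shows "mdeg t < d"
proof (rule ccontr)
  assume "\<not> mdeg t < d"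
  \<comment> \<open>A monomial of O of degree d or more has a divisor of degree exactly d, again in
    O; the count in degree d then yields the contradiction.\<close>
  then obtain r s where "t = r + s" "mdeg s = d" using monom_degree_factor[of d t] by auto
  then have s: "s \<in> {t \<in> \<O>. mdeg t = d}"
    using O t add.commute[of r s] by (auto simp: \<Lambda>_def order_ideal_def)
  have "{t \<in> LTs I. int (mdeg t) = int d} = monoms_eq d" using d by (auto simp: monoms_eq_def)
  moreover have "int (card {t \<in> \<O>. mdeg t = d}) = int (card (monoms_eq d :: 'n monom set))
          - int (quotient_dim (ideal_le I (int d)) (ideal_le I (int d - 1)))"
    using O unfolding \<Lambda>_def degree_compatible_def by blast
  ultimately have "card {t \<in> \<O>. mdeg t = d} = 0"
    by (simp add: quotient_dim_ideal_le[OF ring_subspace_imp_subspace[OF I]])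
  moreover have "finite {t \<in> \<O>. mdeg t = d}" using O by (simp add: \<Lambda>_def order_ideal_def)
  ultimately have "{t \<in> \<O>. mdeg t = d} = {}" by (simp only: card_0_eq)
  then show False using s by blast
qed

end

section \<open>The commuting normal form operators\<close>

text \<open>As a multiset of indeterminates, a monomial can be fed to \<open>fold_mset\<close>,
  which composes commuting operators without fixing an order of the factors.\<close>

definition monom_mset :: "'n::finite monom \<Rightarrow> 'n multiset" where
  "monom_mset t = (\<Sum>j\<in>UNIV. replicate_mset (lookup t j) j)"

lemma count_monom_mset: "count (monom_mset t) i = lookup t i"
  by (simp add: monom_mset_def count_sum)

lemma monom_mset_0: "monom_mset 0 = {#}"
  by (rule multiset_eqI) (simp add: count_monom_mset)

lemma monom_mset_add: "monom_mset (ind j + t) = add_mset j (monom_mset t)"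
  by (rule multiset_eqI) (simp add: count_monom_mset lookup_add ind_def lookup_single when_def)

lemma linear_mult_left: "Vector_Spaces.linear scale scale (\<lambda>p. q * p)"
  unfolding Vector_Spaces.linear_iff
  using vs.vector_space_axioms by (simp add: distrib_left scale_mult_right)

lemma linear_eq_on_mono_span:
  fixes f g :: "('n, 'a::field) mpoly \<Rightarrow> ('n, 'a) mpoly"
  assumes "Vector_Spaces.linear scale scale f" "Vector_Spaces.linear scale scale g"
    and "\<And>t. t \<in> L \<Longrightarrow> f (mon t) = g (mon t)" and "p \<in> mono_span L"
  shows "f p = g p"
  using assms unfolding mono_span_def
  by (intro vsp.linear_eq_on_span[of f g "mon ` L" p]) auto

text \<open>\<open>N\<close> is the normal form modulo \<open>U\<close> and \<open>X j\<close> is multiplication by the \<open>j\<close>-th indeterminate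
  followed by \<open>N\<close>. Stability of \<open>U\<close> makes the \<open>X j\<close> commute, so \<open>\<Phi>\<close>, the action of a polynomial
  on \<open>N 1\<close>, is well defined; its kernel is an ideal containing \<open>U\<close>, and it agrees with \<open>N\<close> in degrees
  up to \<open>d\<close>.\<close>

lemma stable_ideal_Int:
  fixes U :: "('n::finite, 'a::field) mpoly set"
  assumes st: "stable_in U (monoms_le d)"
    and cover: "\<And>p. p \<in> mono_span (monoms_le d) \<Longrightarrow> \<exists>u\<in>U. p - u \<in> mono_span {t. mdeg t < d}"
  shows "ideal_gen U \<inter> mono_span (monoms_le d) \<subseteq> U"
proof -
  let ?L = "monoms_le d :: 'n monom set" and ?L' = "{t :: 'n monom. mdeg t < d}"
  let ?x = "\<lambda>j. mon (ind j) :: ('n, 'a) mpoly"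
  have U: "vs.subspace U" and UL: "U \<subseteq> mono_span ?L"
    using st unfolding stable_in_def by blast+
  \<comment> \<open>The values of N have degree strictly below d, so that multiplying them by an
    indeterminate does not leave <L>.\<close>
  obtain N where N: "Vector_Spaces.linear scale scale N" "\<forall>p. N p \<in> mono_span ?L'"
    "\<forall>u\<in>U. N u = 0" "\<forall>p\<in>vs.span (U \<union> mon ` ?L'). p - N p \<in> U"
    using vs.projection_along[OF U, of "mon ` ?L'"] unfolding mono_span_def by blast
  have NU: "p - N p \<in> U" if p: "p \<in> mono_span ?L" for p
  proof -
    obtain u where "u \<in> U" "p - u \<in> mono_span ?L'" using cover[OF p] by blast
    then have "u + (p - u) \<in> vs.span (U \<union> mon ` ?L')"
      unfolding vs.span_Un mono_span_def using vs.span_base by blast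
    then show ?thesis using N(4) by simp
  qed
  have N_cong: "N p = N q" if "p - q \<in> U" for p q
  proof -
    have "N p - N q = 0" using N(3) that vsp.linear_diff[OF N(1), of p q] by metis
    then show ?thesis by simp
  qed
  have NN: "N (N p) = N p" if "p \<in> mono_span ?L" for p
    using N_cong[OF NU[OF that]] by (rule sym)
  have L'L: "mono_span ?L' \<subseteq> (mono_span ?L :: ('n, 'a) mpoly set)"
    by (rule mono_span_mono) (auto simp: monoms_le_def)
  have mult: "?x j * p \<in> mono_span ?L" if "p \<in> mono_span ?L'" for j p
    using that unfolding in_mono_span_iff keys_mon_mult by (auto simp: monoms_le_def mdeg_add)
  \<comment> \<open>N is also applied to the argument. The operators thus commute on the whole
    polynomial ring, as \<open>comp_fun_commute\<close> requires, and not only on normal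
    forms.\<close>
  define X where "X j p = N (?x j * N p)" for j p
  have X_linear: "Vector_Spaces.linear scale scale (X j)" for j
    using Vector_Spaces.linear_compose[OF Vector_Spaces.linear_compose[OF N(1) linear_mult_left[of "?x j"]] N(1)]
    by (simp add: X_def[abs_def] comp_def)
  have commute: "X i (X j p) = X j (X i p)" for i j p
  proof -
    define a where "a k = ?x k * N p" for k
    have a: "a k \<in> mono_span ?L" for k unfolding a_def using N(2) by (intro mult) blast
    have eq: "X k (X l p) = N (?x k * N (a l))" for k l
      using NN[OF a, of l] by (simp add: X_def a_def)
    \<comment> \<open>The products x_j a_i and x_i a_j may have degree d + 1, but they are equal and
      cancel. What remains of the combination of the remainders is ?w, which lies in <L>, so
      stability puts it into U.\<close>
    let ?w = "?x i * N (a j) - ?x j * N (a i)"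
    have "?x j * a i = ?x i * a j" unfolding a_def by (rule mult.left_commute)
    then have "?x j * (a i - N (a i)) - ?x i * (a j - N (a j)) = ?w"
      by (simp add: right_diff_distrib)
    moreover have "?x j * (a i - N (a i)) - ?x i * (a j - N (a j)) \<in> plus_space U"
      by (intro plus_space_two U NU a)
    moreover have "?w \<in> mono_span ?L"
      using N(2) by (intro vs.subspace_diff mult subspace_mono_span) blast+
    ultimately have "?w \<in> U" using st unfolding stable_in_def by (metis IntI)
    from N_cong[OF this] show ?thesis by (simp only: eq)
  qed
  interpret X: comp_fun_commute X
    by standard (simp add: fun_eq_iff commute)
  define \<phi> where "\<phi> t = fold_mset X (N 1) (monom_mset t)" for t
  have \<phi>_0: "\<phi> 0 = N 1" by (simp add: \<phi>_def monom_mset_0)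
  have \<phi>_add: "\<phi> (ind j + t) = X j (\<phi> t)" for j t
    by (simp add: \<phi>_def monom_mset_add)
  \<comment> \<open>Linear extension takes a function on basis vectors, so the monomial has to be
    recovered from the polynomial \<open>mon t\<close>.\<close>
  define exponent :: "('n, 'a) mpoly \<Rightarrow> 'n monom" where "exponent = inv_into UNIV mon"
  have exponent: "exponent (mon t) = t" for t
    unfolding exponent_def by (simp add: inv_into_f_f[OF inj_mon])
  obtain \<Phi> where \<Phi>: "Vector_Spaces.linear scale scale \<Phi>" "\<forall>x\<in>mon ` UNIV. \<Phi> x = \<phi> (exponent x)"
    using vsp.linear_independent_extend[OF independent_mon[of UNIV], of "\<lambda>x. \<phi> (exponent x)"] by blast
  have \<Phi>_mon: "\<Phi> (mon t) = \<phi> t" for t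
    using \<Phi>(2) exponent by simp
  have \<phi>_low: "t \<in> ?L \<Longrightarrow> \<phi> t = N (mon t)" for t
  proof (induction t rule: monom_induct)
    case zero
    show ?case by (simp add: \<phi>_0 mon_0)
  next
    case (step j t)
    then have t: "mdeg t < d" by (simp add: monoms_le_def mdeg_add)
    then have t': "(mon t :: ('n, 'a) mpoly) \<in> mono_span ?L'" by simp
    then have tL: "(mon t :: ('n, 'a) mpoly) \<in> mono_span ?L" using L'L by blast
    have "\<phi> t = N (mon t)" using step.IH t by (simp add: monoms_le_def)
    then have eq: "\<phi> (ind j + t) = N (?x j * N (mon t))"
      using NN[OF tL] by (simp add: \<phi>_add X_def)
    \<comment> \<open>Both \<open>mon t\<close> and its normal form have degree below d, so the
      product stays in <L> and stability applies.\<close>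
    have "?x j * (mon t - N (mon t)) \<in> U"
    proof (rule stable_in_mult[OF st NU[OF tL]])
      show "?x j * (mon t - N (mon t)) \<in> mono_span ?L"
        using N(2) t' by (intro mult vs.subspace_diff subspace_mono_span) blast+
    qed
    then have "?x j * mon t - ?x j * N (mon t) \<in> U" by (simp only: right_diff_distrib)
    from N_cong[OF this] show ?case by (simp only: eq mon_add)
  qed
  have \<Phi>_low: "\<Phi> p = N p" if "p \<in> mono_span ?L" for p
    by (rule linear_eq_on_mono_span[OF \<Phi>(1) N(1) _ that]) (simp add: \<Phi>_mon \<phi>_low)
  have \<Phi>_mult: "\<Phi> (?x j * p) = X j (\<Phi> p)" for j p
  proof (rule linear_eq_on_mono_span[of "\<lambda>p. \<Phi> (?x j * p)" "\<lambda>p. X j (\<Phi> p)" UNIV])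
    show "Vector_Spaces.linear scale scale (\<lambda>p. \<Phi> (?x j * p))"
      using Vector_Spaces.linear_compose[OF linear_mult_left[of "?x j"] \<Phi>(1)] by (simp add: comp_def)
    show "Vector_Spaces.linear scale scale (\<lambda>p. X j (\<Phi> p))"
      using Vector_Spaces.linear_compose[OF \<Phi>(1) X_linear] by (simp add: comp_def)
    show "\<Phi> (?x j * mon t) = X j (\<Phi> (mon t))" for t
      by (simp only: mon_add[symmetric] \<Phi>_mon \<phi>_add)
    show "p \<in> mono_span UNIV" by (simp add: in_mono_span_iff)
  qed
  have "ring.subspace {p. \<Phi> p = 0}"
  proof (rule ideal_of_ind_closed)
    show "vs.subspace {p. \<Phi> p = 0}" by (rule vsp.linear_subspace_kernel[OF \<Phi>(1)])
    show "?x j * p \<in> {p. \<Phi> p = 0}" if "p \<in> {p. \<Phi> p = 0}" for j p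
      using that vsp.linear_0[OF X_linear, of j] by (simp add: \<Phi>_mult)
  qed
  moreover have "U \<subseteq> {p. \<Phi> p = 0}"
  proof
    fix u assume "u \<in> U"
    then show "u \<in> {p. \<Phi> p = 0}" using \<Phi>_low[of u] UL N(3) by auto
  qed
  ultimately have ker: "ideal_gen U \<subseteq> {p. \<Phi> p = 0}" by (intro ideal_gen_minimal)
  show ?thesis
  proof
    fix p assume p: "p \<in> ideal_gen U \<inter> mono_span ?L"
    then have "N p = 0" using ker \<Phi>_low[of p] by auto
    then show "p \<in> U" using NU[of p] p by simp
  qed
qed

section \<open>The basis transformation\<close>

lemma lookup_row_poly:
  assumes "distinct ts" "j < length ts"
  shows "lookup (row_poly ts M i) (ts ! j) = M $$ (i, j)"
proof -
  have "lookup (row_poly ts M i) (ts ! j) = (\<Sum>k<length ts. if k = j then M $$ (i, k) else 0)"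
    unfolding row_poly_def lookup_sum
  proof (rule sum.cong[OF refl])
    fix k assume "k \<in> {..<length ts}"
    then show "lookup (Poly_Mapping.single (ts ! k) (M $$ (i, k))) (ts ! j) = (if k = j then M $$ (i, k) else 0)"
      using assms by (simp add: lookup_single when_def nth_eq_iff_index_eq)
  qed
  also have "\<dots> = M $$ (i, j)" using assms(2) by simp
  finally show ?thesis .
qed

lemma keys_row_poly: "keys (row_poly ts M i) \<subseteq> set ts"
proof
  fix t assume t: "t \<in> keys (row_poly ts M i)"
  show "t \<in> set ts"
  proof (rule ccontr)
    assume "t \<notin> set ts"
    then have "lookup (Poly_Mapping.single (ts ! k) (M $$ (i, k))) t = 0" if "k < length ts" for k
      using that nth_mem[of k ts] by (auto simp: lookup_single when_def)
    then have "lookup (row_poly ts M i) t = 0"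
      unfolding row_poly_def lookup_sum by (intro sum.neutral) simp
    then show False using t by (simp add: in_keys_iff)
  qed
qed

lemma poly_eqI_on_list:
  assumes "keys p \<subseteq> set ts" "keys q \<subseteq> set ts" "\<And>j. j < length ts \<Longrightarrow> lookup p (ts ! j) = lookup q (ts ! j)"
  shows "p = q"
proof (rule poly_mapping_eqI)
  fix t
  show "lookup p t = lookup q t"
  proof (cases "t \<in> set ts")
    case True
    then show ?thesis using assms(3) by (metis in_set_conv_nth)
  next
    case False
    then show ?thesis using assms(1,2) by (metis in_keys_iff subsetD)
  qed
qed

lemma row_poly_coeff_matrix:
  assumes "distinct ts" "i < length vs" "keys (vs ! i) \<subseteq> set ts"
  shows "row_poly ts (coeff_matrix vs ts) i = vs ! i"
  by (rule poly_eqI_on_list[OF keys_row_poly assms(3)])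
    (simp add: lookup_row_poly[OF assms(1)] coeff_matrix_def assms(2))

lemma row_poly_mult:
  assumes ts: "distinct ts" and P: "P \<in> carrier_mat n m" and B: "B \<in> carrier_mat m (length ts)" and i: "i < n"
  shows "row_poly ts (P * B) i = (\<Sum>k<m. scale (P $$ (i, k)) (row_poly ts B k))"
proof (rule poly_eqI_on_list[OF keys_row_poly])
  show "keys (\<Sum>k<m. scale (P $$ (i, k)) (row_poly ts B k)) \<subseteq> set ts"
    using keys_row_poly unfolding in_mono_span_iff[symmetric]
    by (intro vs.subspace_sum vs.subspace_scale subspace_mono_span) (simp add: in_mono_span_iff)
  fix j assume j: "j < length ts"
  have "(P * B) $$ (i, j) = (\<Sum>k<m. P $$ (i, k) * B $$ (k, j))"
    using P B i j by (simp add: scalar_prod_def atLeast0LessThan)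
  then show "lookup (row_poly ts (P * B) i) (ts ! j) =
      lookup (\<Sum>k<m. scale (P $$ (i, k)) (row_poly ts B k)) (ts ! j)"
    by (simp add: lookup_row_poly[OF ts j] lookup_sum)
qed

text \<open>The coefficients are indexed by A and not by the image, because R need not be injective:
  the zero rows of an echelon form coincide.\<close>

lemma span_image_sum:
  assumes "finite A" "p \<in> vs.span (R ` A)"
  shows "\<exists>c. p = (\<Sum>i\<in>A. scale (c i) (R i))"
  using assms
proof (induction A arbitrary: p rule: finite_induct)
  case empty
  then show ?case by simp
next
  case (insert a A)
  then obtain k where "p - scale k (R a) \<in> vs.span (R ` A)"
    using vs.span_breakdown_eq[of p "R a" "R ` A"] by auto
  then obtain c where c: "p - scale k (R a) = (\<Sum>i\<in>A. scale (c i) (R i))"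
    using insert.IH by blast
  have "(\<Sum>i\<in>insert a A. scale ((c(a := k)) i) (R i)) = scale k (R a) + (\<Sum>i\<in>A. scale ((c(a := k)) i) (R i))"
    using insert.hyps by simp
  also have "(\<Sum>i\<in>A. scale ((c(a := k)) i) (R i)) = (\<Sum>i\<in>A. scale (c i) (R i))"
    using insert.hyps(2) by (intro sum.cong) auto
  also have "scale k (R a) + \<dots> = p" unfolding c[symmetric] by simp
  finally show ?case by (intro exI[of _ "c(a := k)"]) (rule sym)
qed

text \<open>The reduced matrix is P A with P invertible, so the rows of either matrix are
  combinations of the rows of the other.\<close>

lemma gauss_jordan_rows:
  fixes vs :: "('n, 'a::field) mpoly list"
  assumes ts: "distinct ts" and vs: "\<forall>v\<in>set vs. keys v \<subseteq> set ts"
    and M: "M = gauss_jordan_single (coeff_matrix vs ts)"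
  shows "dim_row M = length vs"
    and "vs.span (row_poly ts M ` {..<length vs}) = vs.span (set vs)"
    and "\<exists>f. pivot_fun M f (length ts)"
proof -
  let ?n = "length vs" and ?A = "coeff_matrix vs ts" and ?R = "row_poly ts M"
  have A: "?A \<in> carrier_mat ?n (length ts)" by (simp add: coeff_matrix_def)
  note gj = gauss_jordan_single[OF A M[symmetric]]
  show "dim_row M = ?n" using gj(2) by simp
  show "\<exists>f. pivot_fun M f (length ts)" using gj(2,3) unfolding row_echelon_form_def by simp
  obtain P Q where PQ: "M = P * ?A" "P \<in> carrier_mat ?n ?n" "Q \<in> carrier_mat ?n ?n" "Q * P = 1\<^sub>m ?n"
    using gj(4) by blast
  have QM: "?A = Q * M"
    unfolding PQ(1) using assoc_mult_mat[OF PQ(3,2) A] PQ(4) A by simp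
  have Arow: "row_poly ts ?A i = vs ! i" if "i < ?n" for i
    using that vs by (intro row_poly_coeff_matrix[OF ts that]) simp
  have 1: "?R i \<in> vs.span (set vs)" if i: "i < ?n" for i
  proof -
    have "?R i = (\<Sum>k<?n. scale (P $$ (i, k)) (row_poly ts ?A k))"
      unfolding PQ(1) by (rule row_poly_mult[OF ts PQ(2) A i])
    also have "\<dots> = (\<Sum>k<?n. scale (P $$ (i, k)) (vs ! k))" by (intro sum.cong) (simp_all add: Arow)
    also have "\<dots> \<in> vs.span (set vs)" by (intro vs.span_sum vs.span_scale vs.span_base) simp
    finally show ?thesis .
  qed
  have 2: "vs ! i \<in> vs.span (?R ` {..<?n})" if i: "i < ?n" for i
  proof -
    have "vs ! i = row_poly ts (Q * M) i" using Arow[OF i] QM by simp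
    also have "\<dots> = (\<Sum>k<?n. scale (Q $$ (i, k)) (?R k))"
      by (rule row_poly_mult[OF ts PQ(3) gj(2) i])
    also have "\<dots> \<in> vs.span (?R ` {..<?n})" by (intro vs.span_sum vs.span_scale vs.span_base) simp
    finally show ?thesis .
  qed
  show "vs.span (?R ` {..<?n}) = vs.span (set vs)"
    unfolding vs.span_eq using 1 2 by (auto simp: in_set_conv_nth)
qed

lemma head_eqI:
  assumes "i < length ts" "lookup p (ts ! i) \<noteq> 0" "\<And>j. j < i \<Longrightarrow> lookup p (ts ! j) = 0"
  shows "head ts p = ts ! i"
proof -
  have "filter (\<lambda>t. lookup p t \<noteq> 0) (take i ts) = []"
    using assms by (auto simp: filter_empty_conv in_set_conv_nth)
  then have "filter (\<lambda>t. lookup p t \<noteq> 0) (take i ts @ ts ! i # drop (Suc i) ts)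
      = ts ! i # filter (\<lambda>t. lookup p t \<noteq> 0) (drop (Suc i) ts)"
    using assms(2) by simp
  then show ?thesis using id_take_nth_drop[OF assms(1)] by (simp add: head_def)
qed

lemma basis_transformation_result:
  fixes V :: "('n::finite, 'a::field) mpoly set"
  assumes bt: "basis_transformation V \<O> G"
    and V: "V \<subseteq> mono_span (monoms_le d)" and max: "monoms_le (Max (pdeg ` V)) = (monoms_le d :: 'n monom set)"
    and int: "vs.span V \<inter> mono_span \<O> = {0}"
    and g: "\<And>b. b \<in> monoms_le d - \<O> \<Longrightarrow> g b \<in> vs.span V \<and> mon b - g b \<in> mono_span \<O>"
    and bd: "border \<O> \<subseteq> monoms_le d - \<O>"
  shows "G = g ` border \<O>"
proof -
  obtain vs ts M where vs: "set vs = V" and ts: "distinct ts" "set ts = monoms_le d"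
    and split: "\<And>i j. i < length ts \<Longrightarrow> j < length ts \<Longrightarrow> ts ! i \<notin> \<O> \<Longrightarrow> ts ! j \<in> \<O> \<Longrightarrow> i < j"
    and M: "M = gauss_jordan_single (coeff_matrix vs ts)"
    and G: "G = {g \<in> {row_poly ts M i | i. i < dim_row M} - {0}. head ts g \<in> border \<O>}"
    using bt unfolding basis_transformation_def max by blast
  define n where "n = length vs"
  define R where "R = row_poly ts M"
  have "\<forall>v\<in>set vs. keys v \<subseteq> set ts"
    using V unfolding vs ts(2) in_mono_span_iff[symmetric] by blast
  note rows = gauss_jordan_rows[OF ts(1) this M, folded n_def R_def]
  have span_R: "vs.span (R ` {..<n}) = vs.span V" using rows(2) vs by simp
  obtain f where f: "pivot_fun M f (length ts)" using rows(3) by blast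
  note piv = pivot_funD[OF rows(1) f]
  have RV: "R i \<in> vs.span V" if "i < n" for i
  proof -
    have "R i \<in> vs.span (R ` {..<n})" using that by (intro vs.span_base) blast
    then show ?thesis by (simp only: span_R)
  qed
  have lookup_R: "lookup (R i) (ts ! j) = M $$ (i, j)" if "j < length ts" for i j
    unfolding R_def by (rule lookup_row_poly[OF ts(1) that])
  have keys_R: "keys (R i) \<subseteq> set ts" for i unfolding R_def by (rule keys_row_poly)
  have R_piv: "lookup (R i) (ts ! f k) = (if i = k then 1 else 0)" if "i < n" "k < n" "f k < length ts" for i k
    using lookup_R[OF that(3), of i] piv(4)[OF that(2,3)] piv(5)[OF that(2,3,1)] by auto
  \<comment> \<open>A pivot position equal to the number of columns is the convention of
    \<open>pivot_fun\<close> for a zero row.\<close>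
  have R_zero: "R i = 0" if "i < n" "f i = length ts" for i
    by (rule poly_eqI_on_list[OF keys_R]) (use that piv(2)[of i] in \<open>simp_all add: lookup_R\<close>)
  have head_R: "head ts (R i) = ts ! f i" if i: "i < n" "f i < length ts" for i
  proof (rule head_eqI[OF i(2)])
    show "lookup (R i) (ts ! f i) \<noteq> 0" using R_piv[of i i] i by simp
    show "lookup (R i) (ts ! j) = 0" if "j < f i" for j
      using lookup_R[of j i] piv(2)[OF i(1) that] that i(2) by simp
  qed
  \<comment> \<open>The columns of O are the rightmost ones, so a row with pivot in O is supported
    on O entirely.\<close>
  have piv_not_O: "ts ! f i \<notin> \<O>" if i: "i < n" "f i < length ts" for i
  proof
    assume O: "ts ! f i \<in> \<O>"
    have "t \<in> \<O>" if t: "t \<in> keys (R i)" for t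
    proof (rule ccontr)
      assume "t \<notin> \<O>"
      obtain j where j: "j < length ts" "t = ts ! j"
        using t keys_R[of i] by (metis in_set_conv_nth subsetD)
      then have "j < f i" using split[OF j(1) i(2)] O \<open>t \<notin> \<O>\<close> by blast
      then have "lookup (R i) t = 0" using lookup_R[OF j(1), of i] piv(2)[OF i(1)] j(2) by simp
      then show False using t by (simp add: in_keys_iff)
    qed
    then have "R i \<in> mono_span \<O>" unfolding in_mono_span_iff by blast
    then have "R i = 0" using RV[OF i(1)] int by blast
    then show False using R_piv[of i i] i by simp
  qed
  \<comment> \<open>Pivot columns of the reduced form are unit vectors, so the coefficient of row k
    in a combination of rows is read off at the pivot of row k. Elements of the span are therefore
    determined by their entries at the pivots.\<close>
  have zero_test: "p = 0" if p: "p \<in> vs.span V" "\<And>i. i < n \<Longrightarrow> f i < length ts \<Longrightarrow> lookup p (ts ! f i) = 0" for p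
  proof -
    have "p \<in> vs.span (R ` {..<n})" using p(1) by (simp only: span_R)
    then obtain c where c: "p = (\<Sum>i<n. scale (c i) (R i))" using span_image_sum[OF finite_lessThan] by blast
    have "scale (c k) (R k) = 0" if k: "k < n" for k
    proof (cases "f k < length ts")
      case True
      have "lookup p (ts ! f k) = (\<Sum>i<n. c i * (if i = k then 1 else 0))"
        unfolding c using R_piv[OF _ k True] by (simp add: lookup_sum)
      also have "\<dots> = c k" using k by (simp add: if_distrib cong: if_cong)
      finally have "c k = 0" using p(2)[OF k True] by simp
      then show ?thesis by simp
    next
      case False
      then have "R k = 0" using R_zero[OF k] piv(1)[OF k] by simp
      then show ?thesis by simp
    qed
    then show ?thesis unfolding c by (intro sum.neutral) simp
  qed
  have lookup_g: "lookup (g b) t = lookup (mon b) t" if b: "b \<in> monoms_le d - \<O>" and t: "t \<notin> \<O>" for b t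
  proof -
    have "t \<notin> keys (mon b - g b)" using g[OF b] t unfolding in_mono_span_iff by blast
    then show ?thesis by (simp add: in_keys_iff lookup_minus)
  qed
  have row_g: "R i = g (ts ! f i)" if i: "i < n" "f i < length ts" for i
  proof -
    have b: "ts ! f i \<in> monoms_le d - \<O>"
      using piv_not_O[OF i] nth_mem[OF i(2)] unfolding ts(2) by blast
    have "R i - g (ts ! f i) = 0"
    proof (rule zero_test)
      show "R i - g (ts ! f i) \<in> vs.span V" using RV[OF i(1)] g[OF b] by (intro vs.span_diff) blast+
      fix k assume k: "k < n" "f k < length ts"
      \<comment> \<open>Pivots of different rows differ, since the entry of row i is 1 at its own
        pivot and 0 at the pivot of any other row.\<close>
      have "(ts ! f i = ts ! f k) = (i = k)"
        using R_piv[OF i(1) k] R_piv[OF i(1) i] by (metis zero_neq_one)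
      then show "lookup (R i - g (ts ! f i)) (ts ! f k) = 0"
        using R_piv[OF i(1) k] lookup_g[OF b piv_not_O[OF k]] by (simp add: lookup_minus lookup_mon)
    qed
    then show ?thesis by simp
  qed
  \<comment> \<open>If b were no pivot, \<open>g b\<close> would vanish at every pivot and hence be
    0, leaving b itself in <O>.\<close>
  have pivot: "\<exists>i<n. f i < length ts \<and> ts ! f i = b" if b: "b \<in> monoms_le d - \<O>" for b
  proof (rule ccontr)
    assume no: "\<not> ?thesis"
    have "g b = 0"
    proof (rule zero_test)
      show "g b \<in> vs.span V" using g[OF b] by blast
      fix i assume i: "i < n" "f i < length ts"
      then have "b \<noteq> ts ! f i" using no by blast
      then show "lookup (g b) (ts ! f i) = 0"
        using lookup_g[OF b piv_not_O[OF i]] by (simp add: lookup_mon)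
    qed
    then show False using g[OF b] b by simp
  qed
  have R_ne: "R i \<noteq> 0" if "i < n" "f i < length ts" for i
    using R_piv[OF that(1) that] by (metis lookup_zero zero_neq_one)
  show ?thesis
  proof
    show "G \<subseteq> g ` border \<O>"
    proof
      fix p assume "p \<in> G"
      then obtain i where i: "i < n" "p = R i" "p \<noteq> 0" "head ts p \<in> border \<O>"
        unfolding G rows(1) R_def by blast
      then have fi: "f i < length ts" using R_zero[of i] piv(1)[of i] by fastforce
      then have "head ts p = ts ! f i" "p = g (ts ! f i)" using head_R row_g i by simp_all
      then show "p \<in> g ` border \<O>" using i(4) by simp
    qed
    show "g ` border \<O> \<subseteq> G"
    proof
      fix p assume "p \<in> g ` border \<O>"
      then obtain b where b: "b \<in> border \<O>" "p = g b" by blast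
      then obtain i where i: "i < n" "f i < length ts" "ts ! f i = b" using pivot bd by blast
      have p: "p = R i" using row_g[OF i(1,2)] i(3) b(2) by simp
      then have "p \<in> {row_poly ts M i | i. i < n}" using i(1) unfolding R_def by blast
      moreover have "p \<noteq> 0" unfolding p by (rule R_ne[OF i(1,2)])
      moreover have "head ts p \<in> border \<O>" unfolding p using head_R[OF i(1,2)] i(3) b(1) by simp
      ultimately show "p \<in> G" unfolding G rows(1) by blast
    qed
  qed
qed

section \<open>The generalized border basis algorithm\<close>

text \<open>The factors of r are multiplied in one at a time. Intermediate products have smaller
  degree than the final one, so they lie in <L> because L is cut out by degree alone.\<close>

lemma stable_in_mon_mult:
  assumes st: "stable_in G (monoms_le d)" and p: "p \<in> G"
  shows "mon r * p \<in> mono_span (monoms_le d) \<Longrightarrow> mon r * p \<in> G"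
proof (induction r rule: monom_induct)
  case zero
  show ?case using p by (simp add: mon_0)
next
  case (step j r)
  have eq: "mon (ind j + r) * p = mon (ind j) * (mon r * p)" by (simp only: mon_add mult.assoc)
  have "mon r * p \<in> mono_span (monoms_le d)"
    using step.prems unfolding in_mono_span_iff keys_mon_mult by (auto simp: monoms_le_def mdeg_add)
  from stable_in_mult[OF st step.IH[OF this]] step.prems show ?case unfolding eq by blast
qed

lemma basis_transformation_exists:
  assumes "finite V"
  shows "\<exists>G. basis_transformation V \<O> G"
proof -
  let ?L = "monoms_le (Max (pdeg ` V))"
  obtain vs where vs: "distinct vs" "set vs = V" using finite_distinct_list[OF assms] by blast
  obtain xs where xs: "set xs = ?L - \<O>" "distinct xs"
    using finite_distinct_list[of "?L - \<O>"] by auto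
  obtain ys where ys: "set ys = ?L \<inter> \<O>" "distinct ys"
    using finite_distinct_list[of "?L \<inter> \<O>"] by auto
  have ts: "distinct (xs @ ys)" "set (xs @ ys) = ?L" using xs ys by auto
  have split: "\<forall>i j. i < length (xs @ ys) \<and> j < length (xs @ ys) \<and> (xs @ ys) ! i \<notin> \<O> \<and> (xs @ ys) ! j \<in> \<O> \<longrightarrow> i < j"
  proof (intro allI impI, elim conjE)
    fix i j assume ij: "i < length (xs @ ys)" "j < length (xs @ ys)" "(xs @ ys) ! i \<notin> \<O>" "(xs @ ys) ! j \<in> \<O>"
    have "i < length xs"
    proof (rule ccontr)
      assume "\<not> i < length xs"
      then have "(xs @ ys) ! i \<in> set ys" using ij(1) by (simp add: nth_append)
      then show False using ys(1) ij(3) by blast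
    qed
    moreover have "\<not> j < length xs"
    proof
      assume "j < length xs"
      then have "(xs @ ys) ! j \<in> set xs" by (simp add: nth_append)
      then show False using xs(1) ij(4) by blast
    qed
    ultimately show "i < j" by simp
  qed
  show ?thesis
    unfolding basis_transformation_def using vs ts split by blast
qed

context dc_ordering
begin

text \<open>A combination of elements with different leading terms takes its leading term from one
  of them. So the test in step (3) depends on the stable span only and not on the basis V.\<close>

lemma LTs_span:
  assumes "vs.independent V" "inj_on (LT \<sigma>) V"
  shows "LTs (vs.span V) = LT \<sigma> ` V"
proof -
  have "0 \<notin> V" using assms(1) vs.dependent_zero by blast
  then show ?thesis
    using LT_span[OF _ assms(2)] vs.span_base[of _ V] unfolding LTs_def by blast
qed

definition triangular_basis :: "('n, 'a::field) mpoly set \<Rightarrow> ('n, 'a) mpoly set \<Rightarrow> bool" where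
  "triangular_basis U V \<longleftrightarrow> vs.independent V \<and> vs.span V = U \<and> inj_on (LT \<sigma>) V"

lemma stable_span_eq_ideal:
  fixes F :: "('n, 'a::field) mpoly set"
  assumes F: "F \<subseteq> mono_span (monoms_le d)"
    and top: "monoms_eq d \<subseteq> LTs (stable_span F (monoms_le d))"
  shows "stable_span F (monoms_le d) = ideal_gen F \<inter> mono_span (monoms_le d)" (is "?U = _")
proof
  show "?U \<subseteq> ideal_gen F \<inter> mono_span (monoms_le d)"
    by (rule stable_span_subset_ideal[OF F subspace_ideal_gen ideal_gen_superset])
  have st: "stable_in ?U (monoms_le d)" by (rule stable_span_stable[OF F])
  then have U: "vs.subspace ?U" by (simp add: stable_in_def)
  then have "ideal_gen ?U = ideal_gen F"
    by (intro ideal_gen_stable_span[OF F]) simp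
  moreover have "ideal_gen ?U \<inter> mono_span (monoms_le d) \<subseteq> ?U"
  proof (rule stable_ideal_Int[OF st])
    fix p :: "('n, 'a) mpoly" assume "p \<in> mono_span (monoms_le d)"
    then obtain q r where qr: "p = q + r" "q \<in> vs.span (lead_rep ?U ` (mons_upto (int d) \<inter> LTs ?U))"
      "r \<in> mono_span (mons_upto (int d) - LTs ?U)"
      unfolding monoms_le_eq by (rule LTs_decomposition)
    have "q \<in> ?U" using qr(2) unfolding span_lead_rep[OF U] by blast
    \<comment> \<open>Monomials of a remainder are not leading terms of the stable span, and by
      \<open>top\<close> this rules out degree d. This yields the complement in degrees below
      d.\<close>
    moreover have "mons_upto (int d) - LTs ?U \<subseteq> {t. mdeg t < d}"
      using top by (fastforce simp: monoms_eq_def)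
    then have "p - q \<in> mono_span {t. mdeg t < d}" using qr(1,3) mono_span_mono by auto
    ultimately show "\<exists>u\<in>?U. p - u \<in> mono_span {t. mdeg t < d}" by blast
  qed
  ultimately show "ideal_gen F \<inter> mono_span (monoms_le d) \<subseteq> ?U" by simp
qed

section \<open>Reaching a sufficient degree\<close>

text \<open>The polynomials lying in the stable span for all large d form an ideal containing F: a
  sum needs both thresholds, and a product with an indeterminate needs in addition that d has
  reached its degree. Degrees in a representation by F need not be traced.\<close>

lemma eventually_in_stable_span:
  fixes F :: "('n, 'a::field) mpoly set"
  assumes F: "finite F" and p: "p \<in> ideal_gen F"
  shows "eventually (\<lambda>d. p \<in> stable_span F (monoms_le d)) sequentially"
proof -
  let ?S = "\<lambda>d. stable_span F (monoms_le d)"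
  let ?J = "{p. eventually (\<lambda>d. p \<in> ?S d) sequentially}"
  have Fd: "eventually (\<lambda>d. F \<subseteq> mono_span (monoms_le d)) sequentially"
    unfolding eventually_sequentially
  proof (intro exI allI impI subsetI)
    fix d f assume "Max (pdeg ` F) \<le> d" "f \<in> F"
    then have "pdeg f \<le> Max (pdeg ` F)" using F by (intro Max_ge) auto
    then have "pdeg f \<le> d" using \<open>Max (pdeg ` F) \<le> d\<close> by simp
    then show "f \<in> mono_span (monoms_le d)" by (rule in_monoms_le_span)
  qed
  then have st: "eventually (\<lambda>d. stable_in (?S d) (monoms_le d)) sequentially"
    by (rule eventually_mono) (rule stable_span_stable)
  have "ring.subspace ?J"
  proof (rule ideal_of_ind_closed)
    show "vs.subspace ?J"
    proof (rule vs.subspaceI)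
      show "0 \<in> ?J"
        using st by (auto elim: eventually_mono simp: stable_in_def vs.subspace_0)
      show "x + y \<in> ?J" if "x \<in> ?J" "y \<in> ?J" for x y
        using eventually_conj[OF st eventually_conj[OF that[THEN CollectD]]]
        by (auto elim: eventually_mono simp: stable_in_def vs.subspace_add)
      show "scale c x \<in> ?J" if "x \<in> ?J" for c x
        using eventually_conj[OF st that[THEN CollectD]]
        by (auto elim: eventually_mono simp: stable_in_def vs.subspace_scale)
    qed
    show "mon (ind j) * p \<in> ?J" if "p \<in> ?J" for j p
    proof
      have "eventually (\<lambda>d. stable_in (?S d) (monoms_le d) \<and> p \<in> ?S d \<and> pdeg (mon (ind j) * p) \<le> d) sequentially"
        using that by (intro eventually_conj st eventually_ge_at_top) simp
      then show "eventually (\<lambda>d. mon (ind j) * p \<in> ?S d) sequentially"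
      proof (rule eventually_mono)
        fix d assume d: "stable_in (?S d) (monoms_le d) \<and> p \<in> ?S d \<and> pdeg (mon (ind j) * p) \<le> d"
        then have "mon (ind j) * p \<in> mono_span (monoms_le d)" by (intro in_monoms_le_span) blast
        with d show "mon (ind j) * p \<in> ?S d" using stable_in_mult by blast
      qed
    qed
  qed
  moreover have "F \<subseteq> ?J"
  proof (intro subsetI CollectI)
    fix f assume "f \<in> F"
    show "eventually (\<lambda>d. f \<in> ?S d) sequentially"
      using Fd
    proof (rule eventually_mono)
      fix d assume "F \<subseteq> mono_span (monoms_le d)"
      from stable_span_superset[OF this] show "f \<in> ?S d" using \<open>f \<in> F\<close> by (rule subsetD)
    qed
  qed
  ultimately show ?thesis using ideal_gen_minimal[of F ?J] p by blast
qed

text \<open>Let D exceed the degrees of the finitely many monomials outside LT(I). The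
  representatives for the monomials of degree D are finite in number, so a common threshold places
  them all in the stable span; for d at least D their monomial multiples have all monomials of
  degree d as leading terms. The premise on F in the conclusion guarantees that
  \<open>stable_span\<close> is the intended space.\<close>

lemma eventually_top_degree:
  fixes F :: "('n, 'a::field) mpoly set"
  assumes F: "finite F" and zd: "zero_dimensional (ideal_gen F)"
  shows "eventually (\<lambda>d. F \<subseteq> mono_span (monoms_le d) \<longrightarrow>
    monoms_eq d \<subseteq> LTs (stable_span F (monoms_le d))) sequentially"
proof -
  let ?I = "ideal_gen F" and ?S = "\<lambda>d. stable_span F (monoms_le d)"
  have "finite (mdeg ` (- LTs ?I))"
    using finite_compl_LTs[OF subspace_ideal_gen zd] by simp
  then obtain D where D: "\<forall>k\<in>mdeg ` (- LTs ?I). k < D"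
    using finite_nat_set_iff_bounded by blast
  then have top: "s \<in> LTs ?I" if "mdeg s = D" for s using that by blast
  have "eventually (\<lambda>d. \<forall>s\<in>monoms_eq D. lead_rep ?I s \<in> ?S d) sequentially"
  proof (intro eventually_ball_finite ballI finite_monoms_eq)
    fix s :: "'n monom" assume "s \<in> monoms_eq D"
    then have "lead_rep ?I s \<in> ?I" using top lead_rep(1) by (auto simp: monoms_eq_def)
    then show "eventually (\<lambda>d. lead_rep ?I s \<in> ?S d) sequentially"
      by (rule eventually_in_stable_span[OF F])
  qed
  with eventually_ge_at_top[of D]
  have "eventually (\<lambda>d. D \<le> d \<and> (\<forall>s\<in>monoms_eq D. lead_rep ?I s \<in> ?S d)) sequentially"
    by (rule eventually_conj)
  then show ?thesis
  proof (rule eventually_mono, intro impI subsetI)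
    fix d and t :: "'n monom"
    assume d: "D \<le> d \<and> (\<forall>s\<in>monoms_eq D. lead_rep ?I s \<in> ?S d)"
      and Fd: "F \<subseteq> mono_span (monoms_le d)" and t: "t \<in> monoms_eq d"
    have "D \<le> mdeg t" using d t by (simp add: monoms_eq_def)
    then obtain r s where rs: "t = r + s" "mdeg s = D" using monom_degree_factor by blast
    note rep = lead_rep[OF top[OF rs(2)]]
    have LT: "mon r * lead_rep ?I s \<noteq> 0" "LT \<sigma> (mon r * lead_rep ?I s) = t"
      using LT_mon_mult[OF rep(2), of r] rep(3) rs(1) by simp_all
    have "mon r * lead_rep ?I s \<in> mono_span (monoms_le d)"
      unfolding monoms_le_eq in_mons_upto_span_iff[OF LT(1)] LT(2) using t by (simp add: monoms_eq_def)
    moreover have "lead_rep ?I s \<in> ?S d" using d rs(2) by (simp add: monoms_eq_def)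
    ultimately have "mon r * lead_rep ?I s \<in> ?S d"
      using stable_in_mon_mult[OF stable_span_stable[OF Fd]] by blast
    from LTs_I[OF this LT(1)] show "t \<in> LTs (?S d)" unfolding LT(2) .
  qed
qed

lemma basis_transformation_correct:
  fixes F :: "('n, 'a::field) mpoly set"
  assumes F: "F \<subseteq> mono_span (monoms_le d)"
    and V: "triangular_basis (stable_span F (monoms_le d)) V" and top: "monoms_eq d \<subseteq> LT \<sigma> ` V"
    and O: "\<O> \<in> \<Lambda> (ideal_gen F)" and bt: "basis_transformation V \<O> G"
  shows "border_basis \<O> (ideal_gen F) G"
proof -
  let ?I = "ideal_gen F" and ?L = "monoms_le d :: 'n monom set"
  have V': "vs.independent V" "vs.span V = stable_span F ?L" "inj_on (LT \<sigma>) V"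
    using V by (simp_all add: triangular_basis_def)
  have LTV: "LTs (stable_span F ?L) = LT \<sigma> ` V" using LTs_span[OF V'(1,3)] V'(2) by simp
  have span: "vs.span V = ?I \<inter> mono_span ?L"
    unfolding V'(2) by (rule stable_span_eq_ideal[OF F]) (use top LTV in simp)
  have VI: "V \<subseteq> ?I" and VL: "V \<subseteq> mono_span ?L" using span vs.span_superset[of V] by blast+
  have ord: "order_ideal \<O>" using O by (simp add: \<Lambda>_def)
  obtain G0 where G0: "border_basis \<O> ?I G0" using O by (auto simp: \<Lambda>_def)
  note int = border_basis_decomposition(1)[OF G0] and cover = border_basis_decomposition(2)[OF G0]
  have "0 \<notin> V" using V'(1) vs.dependent_zero by blast
  then have "LT \<sigma> ` V \<subseteq> LTs ?I" using VI unfolding LTs_def by blast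
  then have topI: "monoms_eq d \<subseteq> LTs ?I" using top by (rule subset_trans[rotated])
  have low: "mdeg t < d" if "t \<in> \<O>" for t
    by (rule Lambda_no_top_degree[OF subspace_ideal_gen O topI that])
  have bd: "border \<O> \<subseteq> ?L - \<O>"
  proof
    fix b assume b: "b \<in> border \<O>"
    show "b \<in> ?L - \<O>"
    proof (cases "\<O> = {}")
      case True
      then show ?thesis using b by (simp add: border_def monoms_le_def)
    next
      case False
      then obtain j t where bt: "b = ind j + t" "t \<in> \<O>" "b \<notin> \<O>" using b by (auto simp: border_def)
      then show ?thesis using low[of t] by (simp add: monoms_le_def mdeg_add)
    qed
  qed
  have OL: "mono_span \<O> \<subseteq> (mono_span ?L :: ('n, 'a) mpoly set)"
  proof (rule mono_span_mono)
    show "\<O> \<subseteq> ?L" using low by (auto simp: monoms_le_def intro: less_imp_le)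
  qed
  have "\<exists>q. q \<in> vs.span V \<and> mon b - q \<in> mono_span \<O>" if b: "b \<in> ?L" for b
  proof -
    obtain q r where qr: "q \<in> ?I" "r \<in> mono_span \<O>" "mon b = q + r" using cover[of "mon b"] by blast
    have "mon b - r \<in> mono_span ?L"
      using b qr(2) OL by (intro vs.subspace_diff subspace_mono_span) auto
    then have "q \<in> vs.span V" unfolding span using qr(1,3) by simp
    then show ?thesis using qr(2,3) by (intro exI[of _ q]) simp
  qed
  then have "\<forall>b\<in>?L. \<exists>q. q \<in> vs.span V \<and> mon b - q \<in> mono_span \<O>" by blast
  from bchoice[OF this] obtain g where g: "\<forall>b\<in>?L. g b \<in> vs.span V \<and> mon b - g b \<in> mono_span \<O>" by blast
  have finV: "finite V"
    using vs.independent_span_bound[of "mon ` ?L" V] V'(1) VL unfolding mono_span_def by simp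
  \<comment> \<open>The matrix has columns up to the largest degree in V. Some element of V has a
    leading term of degree d, so this degree is d and the columns are exactly L.\<close>
  have "Max (pdeg ` V) = d"
  proof (rule Max_eqI)
    fix k assume "k \<in> pdeg ` V"
    then obtain v where v: "v \<in> V" "k = pdeg v" by blast
    then have "v = 0 \<or> int (pdeg v) \<le> int d" using VL unfolding pdeg_le_iff monoms_le_eq by blast
    then show "k \<le> d" using v by (auto simp: pdeg_def)
  next
    obtain t :: "'n monom" where t: "t \<in> monoms_eq d" using monoms_eq_nonempty by blast
    then obtain v where v: "v \<in> V" "LT \<sigma> v = t" using top by blast
    then have "v \<noteq> 0" using \<open>0 \<notin> V\<close> by blast
    then have "mdeg t \<le> pdeg v" using mdeg_le_pdeg[OF LT_in_keys] v(2) by blast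
    moreover have "pdeg v \<le> d" using VL v(1) \<open>v \<noteq> 0\<close> pdeg_le_iff[of v "int d"] by (auto simp: monoms_le_eq)
    ultimately have "d = pdeg v" using t by (simp add: monoms_eq_def)
    then show "d \<in> pdeg ` V" using v(1) by blast
  qed (use finV in simp)
  then have max: "monoms_le (Max (pdeg ` V)) = ?L" by simp
  have int': "vs.span V \<inter> mono_span \<O> = {0}"
    using int vs.span_zero vs.subspace_0[OF subspace_mono_span] unfolding span[symmetric] by (simp only: span) blast
  have "G = g ` border \<O>"
    by (rule basis_transformation_result[OF bt VL max int' _ bd]) (use g in blast)
  moreover have "border_basis \<O> ?I (g ` border \<O>)"
  proof (rule border_basisI[OF ord subspace_ideal_gen int])
    fix b assume "b \<in> border \<O>"
    then have "b \<in> ?L" using bd by blast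
    then show "g b \<in> ?I \<and> mon b - g b \<in> mono_span \<O>" using g span by blast
  qed
  ultimately show ?thesis by simp
qed

section \<open>Invariant, progress and termination of the transition system\<close>

text \<open>From step (4) on the state no longer records d, hence the existential quantifier. The
  inclusion of F in <L> is kept throughout the loop because the stable span is only controlled under
  it.\<close>

definition gbb_invariant :: "('n, 'a::field) mpoly set \<Rightarrow> ('n, 'a) gbb_state \<Rightarrow> bool" where
  "gbb_invariant F s = (case s of
      Step2 d \<Rightarrow> F \<subseteq> mono_span (monoms_le d)
    | Step3 d V \<Rightarrow> F \<subseteq> mono_span (monoms_le d) \<and> triangular_basis (stable_span F (monoms_le d)) V
    | Step4 V \<Rightarrow> \<exists>d. F \<subseteq> mono_span (monoms_le d) \<and> triangular_basis (stable_span F (monoms_le d)) V \<and>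
        monoms_eq d \<subseteq> LT \<sigma> ` V
    | Step5 V \<O> \<Rightarrow> (\<exists>d. F \<subseteq> mono_span (monoms_le d) \<and> triangular_basis (stable_span F (monoms_le d)) V \<and>
        monoms_eq d \<subseteq> LT \<sigma> ` V) \<and> \<O> \<in> \<Lambda> (ideal_gen F)
    | Returned \<O> G \<Rightarrow> \<O> \<in> \<Lambda> (ideal_gen F) \<and> border_basis \<O> (ideal_gen F) G)"

lemma ideal_gen_triangular_basis:
  "F \<subseteq> mono_span L \<Longrightarrow> triangular_basis (stable_span F L) V \<Longrightarrow> ideal_gen V = ideal_gen F"
  unfolding triangular_basis_def by (intro ideal_gen_stable_span) simp_all

lemma gbb_invariant_ideal_gen:
  assumes "gbb_invariant F (Step4 V)"
  shows "ideal_gen V = ideal_gen F"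
proof -
  obtain d where "F \<subseteq> mono_span (monoms_le d)" "triangular_basis (stable_span F (monoms_le d)) V"
    using assms by (auto simp: gbb_invariant_def)
  then show ?thesis by (rule ideal_gen_triangular_basis)
qed

lemma gbb_invariant_step:
  assumes step: "gbb_step \<sigma> F s s'" and inv: "gbb_invariant F s"
  shows "gbb_invariant F s'"
  using step
proof cases
  case (compute V d)
  then show ?thesis using inv by (simp add: gbb_invariant_def triangular_basis_def)
next
  case (enlarge d V)
  have "mono_span (monoms_le d) \<subseteq> mono_span (monoms_le (d + 1))"
    by (rule mono_span_mono) (auto simp: monoms_le_def)
  then show ?thesis using enlarge inv by (auto simp: gbb_invariant_def)
next
  case (proceed d V)
  then show ?thesis using inv by (auto simp: gbb_invariant_def)
next
  case (choose \<O> V)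
  then have "ideal_gen V = ideal_gen F" using inv gbb_invariant_ideal_gen by blast
  then show ?thesis using choose inv by (simp add: gbb_invariant_def)
next
  case (return V \<O> G)
  then show ?thesis using inv basis_transformation_correct by (auto simp: gbb_invariant_def)
qed

lemma gbb_invariant_start: "finite F \<Longrightarrow> gbb_invariant F (gbb_start F)"
  by (auto simp: gbb_invariant_def gbb_start_def intro!: in_monoms_le_span)

lemma gbb_invariant_reachable:
  assumes "finite F" "gbb_reachable \<sigma> F s"
  shows "gbb_invariant F s"
  using assms(2) unfolding gbb_reachable_def
proof (induction rule: rtranclp_induct)
  case base
  show ?case by (rule gbb_invariant_start[OF assms(1)])
next
  case (step s s')
  show ?case by (rule gbb_invariant_step[OF step.hyps(2) step.IH])
qed

lemma gbb_progress:
  assumes zd: "zero_dimensional (ideal_gen F)" and inv: "gbb_invariant F s"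
  shows "(\<exists>s'. gbb_step \<sigma> F s s') \<or> (\<exists>\<O> G. s = Returned \<O> G)"
proof (cases s)
  case (Step2 d)
  then have F: "F \<subseteq> mono_span (monoms_le d)" using inv by (simp add: gbb_invariant_def)
  from stable_span_stable[OF F]
  have "vs.subspace (stable_span F (monoms_le d))" "stable_span F (monoms_le d) \<subseteq> mono_span (monoms_le d)"
    unfolding stable_in_def by blast+
  then obtain V where "vs.independent V" "vs.span V = stable_span F (monoms_le d)" "inj_on (LT \<sigma>) V"
    by (rule triangular_basis_exists)
  from gbb_step.compute[OF this] show ?thesis unfolding Step2 by blast
next
  case (Step3 d V)
  show ?thesis
  proof (cases "monoms_eq d \<subseteq> LT \<sigma> ` V")
    case True
    from gbb_step.proceed[OF this] show ?thesis unfolding Step3 by blast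
  next
    case False
    from gbb_step.enlarge[OF this] show ?thesis unfolding Step3 by blast
  qed
next
  case (Step4 V)
  then have "ideal_gen V = ideal_gen F"
    using inv gbb_invariant_ideal_gen by blast
  then have "- LTs (ideal_gen F) \<in> \<Lambda> (ideal_gen V)"
    using compl_LTs_in_Lambda[OF subspace_ideal_gen zd] by simp
  from gbb_step.choose[OF this] show ?thesis unfolding Step4 by blast
next
  case (Step5 V \<O>)
  then obtain d where d: "F \<subseteq> mono_span (monoms_le d)" "triangular_basis (stable_span F (monoms_le d)) V"
    using inv by (auto simp: gbb_invariant_def)
  then have "V \<subseteq> mono_span (monoms_le d)"
    using stable_span_stable[OF d(1)] vs.span_superset[of V] unfolding stable_in_def triangular_basis_def by blast
  \<comment> \<open>An independent subset of the finite-dimensional space <L> is finite, so its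
    elements can be listed as the rows of a matrix.\<close>
  then have "finite V"
    using vs.independent_span_bound[of "mon ` monoms_le d" V] d(2)
    unfolding mono_span_def triangular_basis_def by simp
  then obtain G where "basis_transformation V \<O> G" using basis_transformation_exists by blast
  from gbb_step.return[OF this] show ?thesis unfolding Step5 by blast
next
  case (Returned \<O> G)
  then show ?thesis by blast
qed

text \<open>A round of the loop consists of two transitions, and raising d lowers the measure by 2
  (N - d) - 2 (N - (d + 1)) = 2 as long as d < N. The offsets 4 and 3 order the two transitions of a
  round and keep the loop above the value 2 of step (4).\<close>

fun gbb_measure :: "nat \<Rightarrow> ('m, 'p) state \<Rightarrow> nat" where
  "gbb_measure N (Step2 d) = 2 * (N - d) + 4"
| "gbb_measure N (Step3 d V) = 2 * (N - d) + 3"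
| "gbb_measure N (Step4 V) = 2"
| "gbb_measure N (Step5 V \<O>) = 1"
| "gbb_measure N (Returned \<O> G) = 0"

text \<open>The truncated difference \<open>N - d\<close> causes no harm: \<open>d\<close> is only increased while \<open>d < N\<close>.\<close>

lemma gbb_measure_decreases:
  assumes N: "\<forall>d\<ge>N. F \<subseteq> mono_span (monoms_le d) \<longrightarrow> monoms_eq d \<subseteq> LTs (stable_span F (monoms_le d))"
    and inv: "gbb_invariant F s" and step: "gbb_step \<sigma> F s s'"
  shows "gbb_measure N s' < gbb_measure N s"
  using step
proof cases
  case (enlarge d V)
  have "F \<subseteq> mono_span (monoms_le d)" "triangular_basis (stable_span F (monoms_le d)) V"
    using inv enlarge by (simp_all add: gbb_invariant_def)
  moreover from this have "LTs (stable_span F (monoms_le d)) = LT \<sigma> ` V"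
    using LTs_span[of V] by (simp add: triangular_basis_def)
  ultimately have "d < N" using N enlarge(3) by (metis not_less)
  then show ?thesis using enlarge by simp
qed simp_all

lemma gbb_terminates:
  fixes F :: "('n, 'a::field) mpoly set"
  assumes F: "finite F" and zd: "zero_dimensional (ideal_gen F)"
  shows "\<not> (\<exists>s. s 0 = gbb_start F \<and> (\<forall>k::nat. gbb_step \<sigma> F (s k) (s (Suc k))))"
proof
  assume "\<exists>s. s 0 = gbb_start F \<and> (\<forall>k::nat. gbb_step \<sigma> F (s k) (s (Suc k)))"
  then obtain s where s: "s 0 = gbb_start F" "\<And>k::nat. gbb_step \<sigma> F (s k) (s (Suc k))" by blast
  obtain N where N: "\<forall>d\<ge>N. F \<subseteq> mono_span (monoms_le d) \<longrightarrow> monoms_eq d \<subseteq> LTs (stable_span F (monoms_le d))"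
    using eventually_top_degree[OF F zd] unfolding eventually_sequentially by blast
  have inv: "gbb_invariant F (s k)" for k
  proof (induction k)
    case 0
    show ?case unfolding s(1) by (rule gbb_invariant_start[OF F])
  next
    case (Suc k)
    show ?case by (rule gbb_invariant_step[OF s(2) Suc])
  qed
  have "gbb_measure N (s k) + k \<le> gbb_measure N (s 0)" for k
  proof (induction k)
    case (Suc k)
    then show ?case using gbb_measure_decreases[OF N inv s(2), of k] by simp
  qed simp
  from this[of "Suc (gbb_measure N (s 0))"] show False by simp
qed

end

text \<open>A claim about returned results alone would hold vacuously if runs diverged or got stuck,
  so total correctness of the nondeterministic procedure also requires the first two conjuncts. The
  third identifies the choices of step (4), which are formulated with the ideal of V, with all of
  \<open>\<Lambda> I\<close>, so every order ideal in it is available whenever step (4) is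
  reached.\<close>

theorem proposition4p4:
  fixes F I :: "('n::finite, 'a::field) mpoly set"
    and \<sigma> :: "'n monom rel"
  assumes "degree_compatible_ordering \<sigma>"
    and "finite F"
    and "I = ideal_gen F"
    and "zero_dimensional I"
  shows
    "\<not> (\<exists>s. s 0 = gbb_start F \<and> (\<forall>k::nat. gbb_step \<sigma> F (s k) (s (Suc k)))) \<and>
     (\<forall>s. gbb_reachable \<sigma> F s \<longrightarrow>
        (\<exists>s'. gbb_step \<sigma> F s s') \<or> (\<exists>\<O> G. s = Returned \<O> G)) \<and>
     (\<forall>V. gbb_reachable \<sigma> F (Step4 V) \<longrightarrow>
        (\<forall>\<O>. gbb_step \<sigma> F (Step4 V) (Step5 V \<O>) \<longleftrightarrow> \<O> \<in> \<Lambda> I)) \<and>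
     (\<forall>\<O> G. gbb_reachable \<sigma> F (Returned \<O> G) \<longrightarrow> \<O> \<in> \<Lambda> I \<and> border_basis \<O> I G)"
proof -
  interpret dc_ordering \<sigma> by (rule dc_ordering.intro) fact
  have zd: "zero_dimensional (ideal_gen F)" using assms(3,4) by simp
  note inv = gbb_invariant_reachable[OF assms(2)]
  show ?thesis
    unfolding assms(3)
  proof (intro conjI allI impI)
    show "\<not> (\<exists>s. s 0 = gbb_start F \<and> (\<forall>k::nat. gbb_step \<sigma> F (s k) (s (Suc k))))"
      by (rule gbb_terminates[OF assms(2) zd])
    show "(\<exists>s'. gbb_step \<sigma> F s s') \<or> (\<exists>\<O> G. s = Returned \<O> G)" if "gbb_reachable \<sigma> F s" for s
      by (rule gbb_progress[OF zd inv[OF that]])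
    show "gbb_step \<sigma> F (Step4 V) (Step5 V \<O>) \<longleftrightarrow> \<O> \<in> \<Lambda> (ideal_gen F)"
      if "gbb_reachable \<sigma> F (Step4 V)" for V \<O>
    proof -
      have "ideal_gen V = ideal_gen F" by (rule gbb_invariant_ideal_gen[OF inv[OF that]])
      then show ?thesis by (auto intro: gbb_step.choose elim: gbb_step.cases)
    qed
    show "\<O> \<in> \<Lambda> (ideal_gen F)" "border_basis \<O> (ideal_gen F) G"
      if "gbb_reachable \<sigma> F (Returned \<O> G)" for \<O> G
      using inv[OF that] by (simp_all add: gbb_invariant_def)
  qed
qed

end
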